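(* Let $B\subset\mathbb{R}$ be a bounded Borel set such that $$\sup_{R>0}\Big(R\int_{|\xi|\ge R}|\widehat{\chi_B}(\xi)|^2\,d\xi\Big)<\infty .$$ Then the stationary determinantal point process $\mathbb{P}_{K_B}$ on $\mathbb{R}$ with kernel $K_B(x,y)=\widehat{\chi_B}(x-y)$ is linearly rigid.
   Context: Fourier transform: $\widehat{f}(\xi)=\int_{\mathbb{R}^d} f(x)e^{-i2\pi x\cdot\xi}\,dx$; $\chi_B$ is the indicator function of $B$. The determinantal point process $\mathbb{P}_K$ on $\mathbb{R}^d$ with kernel $K$ is the probability measure on the space of locally finite configurations of $\mathbb{R}^d$ whose $k$-point correlation functions with respect to Lebesgue measure are $\det[K(x_i,x_j)]_{1\le i,j\le k}$, $k\ge1$. Given a stationary point process on $\mathbb{R}^d$ and $\lambda>0$, define the stationary stochastic process $N^{(\lambda)}=(N^{(\lambda)}_n)_{n\in\mathbb{Z}^d}$ by letting $N^{(\lambda)}_n(\mathcal{X})$ be the cardinality of $\mathcal{X}\cap\big(n\lambda+[-\lambda/2,\lambda/2)^d\big)$, where $\mathcal{X}$ is the random configuration. The point process is called linearly rigid if for every $\lambda>0$ the random variable $N^{(\lambda)}_0$ belongs to the closed linear span in $L^2$ of $\{N^{(\lambda)}_n : n\in\mathbb{Z}^d\setminus\{0\}\}$. *)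

theory Defs
  imports "HOL-Probability.Probability" "HOL-Library.Nonpos_Ints" "Jordan_Normal_Form.Determinant"
begin

definition fourier_transform :: "('a::euclidean_space \<Rightarrow> complex) \<Rightarrow> 'a \<Rightarrow> complex" where
  "fourier_transform f \<xi> = (LINT x|lborel. f x * exp (- (\<i> * of_real (2 * pi * inner x \<xi>))))"

definition configurations :: "'a::euclidean_space set set" where
  "configurations = {X. \<forall>C. compact C \<longrightarrow> finite (X \<inter> C)}"

definition configuration_algebra :: "'a::euclidean_space set measure" where
  "configuration_algebra = sigma configurations
     {{X \<in> configurations. card (X \<inter> A) = m} | A m. A \<in> sets borel \<and> bounded A}"

definition point_process :: "'a::euclidean_space set measure \<Rightarrow> bool" where
  "point_process P \<longleftrightarrow> prob_space P \<and> sets P = sets configuration_algebra"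

text \<open>Points of the \<open>k\<close>-th power of the space are functions on \<open>{..<k}\<close>, so that \<open>k\<close> can vary.\<close>

definition distinct_tuples :: "nat \<Rightarrow> 'a set \<Rightarrow> (nat \<Rightarrow> 'a) set" where
  "distinct_tuples k X = {x \<in> {..<k} \<rightarrow>\<^sub>E X. inj_on x {..<k}}"

text \<open>
  The function \<open>\<rho>\<close> is a \<open>k\<close>-point correlation function of \<open>P\<close> with respect to Lebesgue measure if the
  expected sum of \<open>\<phi>\<close> over the \<open>k\<close>-tuples of distinct points of the configuration equals the
  integral of \<open>\<phi> \<cdot> \<rho>\<close>, for every measurable \<open>\<phi> \<ge> 0\<close>. Correlation functions are nonnegative by
  definition; \<open>\<rho>\<close> has complex type because it is to be a determinant of a complex kernel.
\<close>

definition correlation_function ::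
    "'a::euclidean_space set measure \<Rightarrow> nat \<Rightarrow> ((nat \<Rightarrow> 'a) \<Rightarrow> complex) \<Rightarrow> bool" where
  "correlation_function P k \<rho> \<longleftrightarrow>
     \<rho> \<in> borel_measurable (Pi\<^sub>M {..<k} (\<lambda>_. lborel)) \<and>
     (AE x in Pi\<^sub>M {..<k} (\<lambda>_. lborel). \<rho> x \<in> \<real>\<^sub>\<ge>\<^sub>0) \<and>
     (\<forall>\<phi> \<in> borel_measurable (Pi\<^sub>M {..<k} (\<lambda>_. lborel)).
        (\<integral>\<^sup>+ X. (\<integral>\<^sup>+ x. \<phi> x \<partial>count_space (distinct_tuples k X)) \<partial>P) =
        (\<integral>\<^sup>+ x. \<phi> x * ennreal (Re (\<rho> x)) \<partial>Pi\<^sub>M {..<k} (\<lambda>_. lborel)))"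

definition determinantal_process ::
    "('a::euclidean_space \<Rightarrow> 'a \<Rightarrow> complex) \<Rightarrow> 'a set measure \<Rightarrow> bool" where
  "determinantal_process K P \<longleftrightarrow> point_process P \<and>
     (\<forall>k\<ge>1. correlation_function P k
        (\<lambda>x. Determinant.det (Matrix.mat k k (\<lambda>(i, j). K (x i) (x j)))))"

definition square_integrable :: "'b measure \<Rightarrow> ('b \<Rightarrow> real) set" where
  "square_integrable M = {f \<in> borel_measurable M. integrable M (\<lambda>x. (f x)\<^sup>2)}"

definition L2_closed_span :: "'b measure \<Rightarrow> ('b \<Rightarrow> real) set \<Rightarrow> ('b \<Rightarrow> real) set" where
  "L2_closed_span M S = {f \<in> square_integrable M. \<forall>\<epsilon>>0. \<exists>F c. finite F \<and> F \<subseteq> S \<and>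
     sqrt (LINT x|M. (f x - (\<Sum>g\<in>F. c g * g x))\<^sup>2) < \<epsilon>}"

definition integer_lattice :: "'a::euclidean_space set" where
  "integer_lattice = {n. \<forall>b\<in>Basis. inner n b \<in> \<int>}"

definition box_at :: "real \<Rightarrow> 'a::euclidean_space \<Rightarrow> 'a set" where
  "box_at l n =
     {x. \<forall>b\<in>Basis. inner (l *\<^sub>R n) b - l / 2 \<le> inner x b \<and> inner x b < inner (l *\<^sub>R n) b + l / 2}"

definition box_count :: "real \<Rightarrow> 'a::euclidean_space \<Rightarrow> 'a set \<Rightarrow> real" where
  "box_count l n X = real (card (X \<inter> box_at l n))"

text \<open>
  Square integrability of all the counts is part of the definition, so that the \<open>L\<^sup>2\<close> span is taken
  inside \<open>L\<^sup>2\<close> and no Bochner integral takes its default value.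
\<close>

definition linearly_rigid :: "'a::euclidean_space set measure \<Rightarrow> bool" where
  "linearly_rigid P \<longleftrightarrow> (\<forall>l>0.
     (\<forall>n\<in>integer_lattice. box_count l n \<in> square_integrable P) \<and>
     box_count l 0 \<in> L2_closed_span P (box_count l ` (integer_lattice - {0})))"

end

theory Submission
  imports Defs
begin

text \<open>
  Write \<open>k(t)\<close> for the squared modulus of the Fourier transform of \<open>\<chi>\<^sub>B\<close> at \<open>t\<close>, \<open>b\<close> for the
  Lebesgue measure of \<open>B\<close>, \<open>I\<^sub>n\<close> for the box of side \<open>l\<close> centred at \<open>n l\<close>, \<open>N\<^sub>n\<close> for the number of
  points in \<open>I\<^sub>n\<close>, and \<open>\<kappa>\<^sub>j\<close> for the integral of \<open>k(x - y)\<close> over \<open>I\<^sub>0 \<times> I\<^sub>j\<close>.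

  The first two correlation functions are \<open>b\<close> and \<open>b\<^sup>2 - k(x - y)\<close>, so the covariance of \<open>N\<^sub>n\<close> and
  \<open>N\<^sub>m\<close> is \<open>b l\<close> (only if \<open>n = m\<close>) minus \<open>\<kappa>\<close> at \<open>m - n\<close>. By Plancherel the integral of \<open>k\<close> over the
  line is \<open>b\<close>, so the \<open>\<kappa>\<^sub>j\<close> add up to \<open>b l\<close> and the covariances sum to zero: the counts are
  hyperuniform. Using this cancellation the variance of \<open>\<Sum> c\<^sub>n N\<^sub>n\<close> becomes the Dirichlet form
  \<open>(1/2) \<Sum>\<^sub>j \<kappa>\<^sub>j \<Sum>\<^sub>n (c (n + j) - c n)\<^sup>2\<close>, an analogue of a Sobolev norm of order \<open>1/2\<close>, since the
  hypothesis on \<open>B\<close> makes the sum of \<open>\<kappa>\<^sub>j\<close> over \<open>\<bar>j\<bar> \<ge> m\<close> of order \<open>1/m\<close>. A point has zero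
  capacity for such a form: there are finitely supported \<open>c\<close> with \<open>c 0 = 1\<close> and arbitrarily small
  energy, for instance those that decrease logarithmically. Here \<open>c\<close> is an average of \<open>K\<close> tent
  functions of geometrically growing widths. Each of them has energy of order one, but a difference
  \<open>j\<close> of indices is felt essentially only by the tents whose width is comparable to \<open>\<bar>j\<bar>\<close>, so that
  the energy of the average is of order \<open>1/K\<close>.

  The linear span is not that of the centred variables, so \<open>\<Sum> c\<^sub>n N\<^sub>n\<close> must also have mean zero,
  that is, \<open>\<Sum> c\<^sub>n = 0\<close>. This is arranged by subtracting a multiple of the uniform probability on
  \<open>{1..M}\<close> for a large \<open>M\<close>: for a given \<open>K\<close> the energy that this adds is
  at most of order \<open>1/M\<close>. Then \<open>\<Sum> c\<^sub>n N\<^sub>n\<close> is small in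
  \<open>L\<^sup>2\<close>, and since \<open>c 0 = 1\<close> this says that \<open>N\<^sub>0\<close> is close to a combination of the other counts.

  The choice of \<open>c\<close> is the purely discrete lemma \<open>coefficients_with_small_variance\<close>; the covariances
  are computed in \<open>box_count_product\<close>. Of Plancherel only the inequality that bounds the
  integral of \<open>k\<close> from below by \<open>b\<close> enters, as \<open>plancherel_lower_bound\<close>; the bounds
  on \<open>\<kappa>\<close> are \<open>coupling_tail\<close> and \<open>coupling_total\<close>.
\<close>

section \<open>Coefficients with small variance\<close>

definition tent :: "real \<Rightarrow> int \<Rightarrow> real" where
  "tent q n = max 0 (1 - \<bar>of_int n\<bar> / q)"

definition tent_average :: "nat \<Rightarrow> int \<Rightarrow> real" where
  "tent_average K n = (\<Sum>i<K. tent (4 ^ i) n) / real K"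

lemma sum_shift_window:
  fixes f :: "int \<Rightarrow> real"
  assumes "\<And>n. \<bar>n\<bar> > L \<Longrightarrow> f n = 0" "L + \<bar>j\<bar> \<le> H"
  shows "(\<Sum>n\<in>{-H..H}. f (n + j)) = (\<Sum>n\<in>{-L..L}. f n)"
proof -
  have "(\<Sum>n\<in>{-L..L}. f n) = (\<Sum>n\<in>{-H+j..H+j}. f n)"
    using assms by (intro sum.mono_neutral_left) (auto simp: abs_if split: if_splits)
  also have "\<dots> = (\<Sum>n\<in>{-H..H}. f (n + j))"
    by (rule sum.reindex_bij_witness[where i = "\<lambda>n. n + j" and j = "\<lambda>n. n - j"]) auto
  finally show ?thesis by simp
qed

text \<open>
  The identity \<open>2 c\<^sub>n c\<^sub>m = c\<^sub>n\<^sup>2 + c\<^sub>m\<^sup>2 - (c\<^sub>m - c\<^sub>n)\<^sup>2\<close> turns the variance into the energy of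
  the increments of \<open>c\<close>, up to a multiple of \<open>v - \<Sum> \<kappa>\<^sub>j\<close>, which tends to a nonpositive limit in the
  application. The range \<open>J\<close> of differences and the window for \<open>n\<close> are large enough for every shifted
  copy of the support of \<open>c\<close> to be seen completely.
\<close>

lemma quadratic_form_via_increments:
  fixes c \<kappa> :: "int \<Rightarrow> real" and J L :: int
  assumes supp: "\<And>n. \<bar>n\<bar> > L \<Longrightarrow> c n = 0" and J: "2 * L \<le> J" "0 \<le> L"
  shows "v * (\<Sum>n\<in>{-L..L}. (c n)\<^sup>2) - (\<Sum>n\<in>{-L..L}. \<Sum>m\<in>{-L..L}. c n * c m * \<kappa> (m - n)) =
    (\<Sum>n\<in>{-L..L}. (c n)\<^sup>2) * (v - (\<Sum>j\<in>{-J..J}. \<kappa> j)) +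
    (\<Sum>j\<in>{-J..J}. \<kappa> j * (\<Sum>n\<in>{-(L+J)..L+J}. (c (n + j) - c n)\<^sup>2)) / 2"
proof -
  define N where "N = (\<Sum>n\<in>{-L..L}. (c n)\<^sup>2)"
  define A where "A j = (\<Sum>n\<in>{-L..L}. c n * c (n + j))" for j
  have S: "(\<Sum>n\<in>{-(L+J)..L+J}. (c (n + j) - c n)\<^sup>2) = 2 * N - 2 * A j" if "j \<in> {-J..J}" for j
  proof -
    have 1: "(\<Sum>n\<in>{-(L+J)..L+J}. (c (n + j))\<^sup>2) = N"
      unfolding N_def using sum_shift_window[of L "\<lambda>n. (c n)\<^sup>2" j "L + J"] supp that J by auto
    have 2: "(\<Sum>n\<in>{-(L+J)..L+J}. (c n)\<^sup>2) = N"
      unfolding N_def using sum_shift_window[of L "\<lambda>n. (c n)\<^sup>2" 0 "L + J"] supp that J by auto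
    have 3: "(\<Sum>n\<in>{-(L+J)..L+J}. c n * c (n + j)) = A j"
      unfolding A_def using supp J by (intro sum.mono_neutral_right) auto
    have "(\<Sum>n\<in>{-(L+J)..L+J}. (c (n + j) - c n)\<^sup>2) =
       (\<Sum>n\<in>{-(L+J)..L+J}. (c (n + j))\<^sup>2 + (c n)\<^sup>2 - 2 * (c n * c (n + j)))"
      by (intro sum.cong) (auto simp: power2_eq_square algebra_simps)
    also have "\<dots> = N + N - 2 * A j"
      by (simp only: sum_subtractf sum.distrib 1 2 sum_distrib_left[symmetric] 3)
    finally show ?thesis by simp
  qed
  have "(\<Sum>m\<in>{-L..L}. c n * c m * \<kappa> (m - n)) = (\<Sum>j\<in>{-J..J}. \<kappa> j * (c n * c (n + j)))"
    if "n \<in> {-L..L}" for n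
  proof -
    have "(\<Sum>m\<in>{-L..L}. c n * c m * \<kappa> (m - n)) = (\<Sum>m\<in>{n-J..n+J}. c n * c m * \<kappa> (m - n))"
      using supp that J by (intro sum.mono_neutral_left) auto
    also have "\<dots> = (\<Sum>j\<in>{-J..J}. \<kappa> j * (c n * c (n + j)))"
      by (rule sum.reindex_bij_witness[where i = "\<lambda>j. n + j" and j = "\<lambda>m. m - n"]) auto
    finally show ?thesis .
  qed
  then have "(\<Sum>n\<in>{-L..L}. \<Sum>m\<in>{-L..L}. c n * c m * \<kappa> (m - n)) =
      (\<Sum>n\<in>{-L..L}. \<Sum>j\<in>{-J..J}. \<kappa> j * (c n * c (n + j)))"
    by (rule sum.cong[OF refl])
  also have "\<dots> = (\<Sum>j\<in>{-J..J}. \<kappa> j * A j)"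
    by (subst sum.swap) (simp add: A_def sum_distrib_left)
  finally have D: "(\<Sum>n\<in>{-L..L}. \<Sum>m\<in>{-L..L}. c n * c m * \<kappa> (m - n)) = (\<Sum>j\<in>{-J..J}. \<kappa> j * A j)" .
  have E: "(\<Sum>j\<in>{-J..J}. \<kappa> j * (\<Sum>n\<in>{-(L+J)..L+J}. (c (n + j) - c n)\<^sup>2))
      = 2 * ((\<Sum>j\<in>{-J..J}. \<kappa> j) * N - (\<Sum>j\<in>{-J..J}. \<kappa> j * A j))"
  proof -
    have "\<kappa> j * (\<Sum>n\<in>{-(L+J)..L+J}. (c (n + j) - c n)\<^sup>2) = 2 * (\<kappa> j * N - \<kappa> j * A j)"
      if "j \<in> {-J..J}" for j
      unfolding S[OF that] by (simp add: algebra_simps)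
    then show ?thesis
      by (simp add: sum_distrib_right sum_subtractf sum_distrib_left[symmetric])
  qed
  show ?thesis
    unfolding D E N_def[symmetric]
    by (simp add: field_simps)
qed

lemma L2_set_sum_le:
  assumes "finite I"
  shows "L2_set (\<lambda>n. \<Sum>i\<in>I. f i n) A \<le> (\<Sum>i\<in>I. L2_set (f i) A)"
  using assms
proof (induction I)
  case (insert i I)
  then show ?case
    using L2_set_triangle_ineq[of "f i" "\<lambda>n. \<Sum>i\<in>I. f i n" A] by simp
qed (simp add: L2_set_def)

lemma tent_bounds: "q > 0 \<Longrightarrow> 0 \<le> tent q n" "q > 0 \<Longrightarrow> tent q n \<le> 1"
  by (auto simp: tent_def)

lemma tent_lipschitz:
  assumes "q > 0"
  shows "\<bar>tent q (n + j) - tent q n\<bar> \<le> \<bar>of_int j\<bar> / q"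
proof -
  have *: "\<bar>(1 - \<bar>of_int (n + j)\<bar> / q) - (1 - \<bar>of_int n\<bar> / q)\<bar> \<le> \<bar>of_int j\<bar> / q"
  proof -
    have "\<bar>(1 - \<bar>of_int (n + j)\<bar> / q) - (1 - \<bar>of_int n\<bar> / q)\<bar> = \<bar>\<bar>of_int n\<bar> - \<bar>of_int (n + j)\<bar>\<bar> / q"
      using assms by (simp add: diff_divide_distrib[symmetric])
    also have "\<dots> \<le> \<bar>of_int j\<bar> / q"
      using assms by (intro divide_right_mono) auto
    finally show ?thesis .
  qed
  then show ?thesis unfolding tent_def by (auto simp: max_def abs_if split: if_splits)
qed

text \<open>
  At most \<open>4 \<cdot> 4^i\<close> of the increments are nonzero, and each is at most \<open>1\<close> and at most
  \<open>\<bar>j\<bar> / 4^i\<close>. Widths \<open>4^i\<close> are taken in order that the square root of the size of the support is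
  the integral power \<open>2^i\<close>.
\<close>

lemma L2_set_tent_increment:
  fixes i :: nat and W :: "int set"
  assumes W: "finite W"
  shows "L2_set (\<lambda>n. tent (4 ^ i) (n + j) - tent (4 ^ i) n) W \<le> 2 * 2 ^ i"
    and "L2_set (\<lambda>n. tent (4 ^ i) (n + j) - tent (4 ^ i) n) W \<le> 2 * (\<bar>of_int j\<bar> / 2 ^ i)"
proof -
  let ?d = "\<lambda>n. tent (4 ^ i) (n + j) - tent (4 ^ i) n"
  define q :: int where "q = 4 ^ i"
  have q: "q > 0" "real_of_int q = 4 ^ i" by (auto simp: q_def)
  let ?E = "{-q+1..q-1} \<union> {-q+1-j..q-1-j}"
  have zero: "?d n = 0" if "n \<notin> ?E" for n
  proof -
    have "\<bar>n\<bar> \<ge> q" "\<bar>n + j\<bar> \<ge> q" using that by auto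
    then have "\<bar>real_of_int n\<bar> \<ge> 4 ^ i" "\<bar>real_of_int (n + j)\<bar> \<ge> 4 ^ i"
      by (metis q(2) of_int_abs of_int_le_iff)+
    then show ?thesis unfolding tent_def by (simp add: max_def)
  qed
  have cE: "real (card ?E) \<le> 4 * 4 ^ i"
  proof -
    have "card ?E \<le> card {-q+1..q-1} + card {-q+1-j..q-1-j}" by (rule card_Un_le)
    also have "\<dots> \<le> 4 * nat q" using q by simp
    finally have "real (card ?E) \<le> real (4 * nat q)" by linarith
    also have "\<dots> = 4 * 4 ^ i" using q by simp
    finally show ?thesis .
  qed
  have gen: "L2_set ?d W \<le> 2 * 2 ^ i * u" if u: "0 \<le> u" "\<And>n. \<bar>?d n\<bar> \<le> u" for u
  proof -
    have "(\<Sum>n\<in>W. (?d n)\<^sup>2) \<le> (\<Sum>n\<in>W \<union> ?E. (?d n)\<^sup>2)"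
      using W by (intro sum_mono2) auto
    also have "\<dots> = (\<Sum>n\<in>?E. (?d n)\<^sup>2)"
      using W zero by (intro sum.mono_neutral_right) auto
    also have "\<dots> \<le> (\<Sum>n\<in>?E. u\<^sup>2)"
      using u by (intro sum_mono) (metis abs_of_nonneg abs_le_square_iff)
    also have "\<dots> = real (card ?E) * u\<^sup>2" by simp
    also have "\<dots> \<le> (4 * 4 ^ i) * u\<^sup>2" using cE by (intro mult_right_mono) auto
    also have "\<dots> = (2 * 2 ^ i * u)\<^sup>2"
      using power_mult_distrib[of "2::real" 2 i] by (simp add: power2_eq_square)
    finally show ?thesis
      unfolding L2_set_def using u by (intro real_le_lsqrt) (auto intro: sum_nonneg)
  qed
  have "\<bar>?d n\<bar> \<le> 1" for n
    using tent_bounds[of "4^i" n] tent_bounds[of "4^i" "n+j"] by (auto simp: abs_le_iff)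
  from gen[OF _ this] show "L2_set ?d W \<le> 2 * 2 ^ i" by simp
  have "L2_set ?d W \<le> 2 * 2 ^ i * (\<bar>of_int j\<bar> / 4 ^ i)"
    using tent_lipschitz[of "4^i" n for n] by (intro gen) auto
  also have "\<dots> = 2 * (\<bar>of_int j\<bar> / 2 ^ i)"
    using power_mult_distrib[of "2::real" 2 i] by (simp add: field_simps)
  finally show "L2_set ?d W \<le> 2 * (\<bar>of_int j\<bar> / 2 ^ i)" .
qed

text \<open>
  The bounds \<open>2^i\<close> and \<open>x / 2^i\<close> form two geometric series that cross at \<open>2^i\<close> near
  \<open>sqrt x\<close>, so that the sum is comparable to its largest term, with a constant independent of \<open>K\<close>. This
  is where the gain of a factor \<open>K\<close> over the trivial bound comes from.
\<close>

lemma geometric_scales_sum: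
  fixes x :: real
  assumes x: "x \<ge> 1" and f: "\<And>i. f i \<le> 2 ^ i" "\<And>i. f i \<le> x / 2 ^ i"
  shows "(\<Sum>i<K. f i) \<le> 4 * sqrt x" "(\<Sum>i<K. f i) \<le> 2 ^ K"
proof -
  have two: "(\<Sum>i<n. (2::real) ^ i) \<le> 2 ^ n" for n :: nat
    by (induction n) auto
  show "(\<Sum>i<K. f i) \<le> 2 ^ K"
    using sum_mono[of "{..<K}" f "\<lambda>i. 2 ^ i"] f(1) two[of K] by (auto intro: order_trans)
  obtain p :: nat where p: "2 ^ p \<le> sqrt x" "sqrt x < 2 ^ Suc p"
  proof -
    have ex: "\<exists>n::nat. sqrt x < 2 ^ n" by (rule real_arch_pow) simp
    define n where "n = (LEAST n::nat. sqrt x < 2 ^ n)"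
    have n: "sqrt x < 2 ^ n" unfolding n_def using ex by (rule LeastI_ex)
    have "n \<noteq> 0" using n x by (cases n) auto
    then obtain m where m: "n = Suc m" by (cases n) auto
    have "\<not> sqrt x < 2 ^ m" using not_less_Least[of m "\<lambda>n. sqrt x < 2 ^ n"] m unfolding n_def by auto
    with n m that[of m] show ?thesis by auto
  qed
  have x2: "x = sqrt x * sqrt x" using x by simp
  \<comment> \<open>The two bounds cross between \<open>2^p\<close> and \<open>2^(p + 1)\<close>; beyond the crossing, the slack \<open>2 x / 2^n\<close> is the rest of the second geometric series.\<close>
  have "(\<Sum>i<n. f i) \<le> 4 * sqrt x - (if n \<ge> Suc p then 2 * x / 2 ^ n else 4 * sqrt x - 2 ^ n)" for n
  proof (induction n)
    case 0 then show ?case by simp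
  next
    case (Suc n)
    show ?case
    proof (cases "n \<ge> Suc p")
      case True
      then show ?thesis using Suc f(2)[of n] by (auto simp: field_simps)
    next
      case False
      have A: "(\<Sum>i<Suc n. f i) \<le> 2 ^ Suc n"
        using Suc False f(1)[of n] by auto
      show ?thesis
      proof (cases "n = p")
        case True
        have "2 * x / 2 ^ Suc p = sqrt x * (sqrt x / 2 ^ p)" using x2 by (simp add: field_simps)
        also have "\<dots> \<le> sqrt x * 2"
          using p x by (intro mult_left_mono) (auto simp: field_simps)
        finally show ?thesis using A p True by auto
      next
        case False
        then show ?thesis using A \<open>\<not> n \<ge> Suc p\<close> by auto
      qed
    qed
  qed
  note key = this
  show "(\<Sum>i<K. f i) \<le> 4 * sqrt x"
  proof (cases "K \<ge> Suc p")
    case True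
    then show ?thesis using key[of K] x by (auto intro: order_trans)
  next
    case False
    then have "(2::real) ^ K \<le> 2 ^ p" by (intro power_increasing) auto
    moreover have "(\<Sum>i<K. f i) \<le> 2 ^ K" using key[of K] False by simp
    ultimately show ?thesis using p x real_sqrt_ge_zero[of x] by linarith
  qed
qed

text \<open>
  Minkowski's inequality over the scales. A single tent satisfies such a bound without the factor
  \<open>1 / K\<^sup>2\<close>, which is what the averaging gains.
\<close>

lemma tent_average_increment:
  assumes W: "finite W" and K: "K > 0"
  shows "(\<Sum>n\<in>W. (tent_average K (n + j) - tent_average K n)\<^sup>2) \<le> 64 / (real K)\<^sup>2 * min \<bar>real_of_int j\<bar> (4 ^ K)"
proof (cases "j = 0")
  case False
  let ?d = "\<lambda>i n. tent (4 ^ i) (n + j) - tent (4 ^ i) n"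
  define f where "f i = L2_set (?d i) W / 2" for i
  have f: "f i \<le> 2 ^ i" "f i \<le> \<bar>real_of_int j\<bar> / 2 ^ i" for i
    unfolding f_def using L2_set_tent_increment[OF W, of i j] by (auto simp: field_simps)
  have j1: "\<bar>real_of_int j\<bar> \<ge> 1" using False by linarith
  have f0: "f i \<ge> 0" for i by (simp add: f_def)
  define T where "T = (\<Sum>i<K. f i)"
  have T: "0 \<le> T" "T \<le> 4 * sqrt \<bar>real_of_int j\<bar>" "T \<le> 2 ^ K"
    unfolding T_def using geometric_scales_sum[OF j1, of f K] f by (auto intro: sum_nonneg f0)
  have "T\<^sup>2 \<le> (4 * sqrt \<bar>real_of_int j\<bar>)\<^sup>2" "T\<^sup>2 \<le> (2 ^ K)\<^sup>2"
    by (rule power_mono[OF T(2) T(1)], rule power_mono[OF T(3) T(1)])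
  moreover have "((2::real) ^ K)\<^sup>2 = 4 ^ K"
    using power_mult_distrib[of "2::real" 2 K] by (simp add: power2_eq_square)
  moreover have "(4 * sqrt \<bar>real_of_int j\<bar>)\<^sup>2 = 16 * \<bar>real_of_int j\<bar>"
    by (simp add: power_mult_distrib)
  ultimately have T2: "T\<^sup>2 \<le> 16 * \<bar>real_of_int j\<bar>" "T\<^sup>2 \<le> 4 ^ K"
    by metis+
  have eq: "tent_average K (n + j) - tent_average K n = (\<Sum>i<K. ?d i n) / real K" for n
    unfolding tent_average_def by (simp add: sum_subtractf diff_divide_distrib)
  have "(\<Sum>n\<in>W. (tent_average K (n + j) - tent_average K n)\<^sup>2) = (L2_set (\<lambda>n. \<Sum>i<K. ?d i n) W)\<^sup>2 / (real K)\<^sup>2"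
    unfolding eq L2_set_def by (simp only: power_divide sum_divide_distrib[symmetric] real_sqrt_pow2[OF sum_nonneg] zero_le_power2)
  also have "\<dots> \<le> (2 * T)\<^sup>2 / (real K)\<^sup>2"
  proof (intro divide_right_mono power_mono)
    show "L2_set (\<lambda>n. \<Sum>i<K. ?d i n) W \<le> 2 * T"
      using L2_set_sum_le[of "{..<K}" ?d W] unfolding T_def f_def by (simp add: sum_divide_distrib[symmetric])
  qed auto
  also have "\<dots> \<le> (64 * min \<bar>real_of_int j\<bar> (4 ^ K)) / (real K)\<^sup>2"
  proof (intro divide_right_mono)
    have "T\<^sup>2 \<le> 16 * 4 ^ K" using T2(2) zero_le_power[of "4::real" K] by linarith
    then show "(2 * T)\<^sup>2 \<le> 64 * min \<bar>real_of_int j\<bar> (4 ^ K)"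
      using T2(1) by (simp add: power_mult_distrib min_def)
  qed simp
  finally show ?thesis by simp
qed simp

lemma tent_average_0: "K > 0 \<Longrightarrow> tent_average K 0 = 1"
  by (simp add: tent_average_def tent_def)

lemma tent_average_support:
  assumes "\<bar>n\<bar> > 4 ^ K" shows "tent_average K n = 0"
proof -
  have "tent (4 ^ i) n = 0" if "i < K" for i
  proof -
    have "(4::real) ^ i \<le> 4 ^ K" using that by (intro power_increasing) auto
    moreover have "(4::real) ^ K < \<bar>real_of_int n\<bar>"
      using assms by (metis of_int_abs of_int_less_iff of_int_numeral of_int_power)
    ultimately have "4 ^ i < \<bar>real_of_int n\<bar>" by (rule le_less_trans)
    then show ?thesis by (auto simp: tent_def max_def field_simps)
  qed
  then show ?thesis by (simp add: tent_average_def)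
qed

lemma harmonic_sum_bound: "(\<Sum>m=1..4 ^ K. 1 / real m) \<le> 3 * real K + 1"
proof (induction K)
  case (Suc K)
  have "{1..4 ^ Suc K} = {1..4 ^ K} \<union> {4 ^ K + 1..4 ^ Suc K :: nat}"
    by auto
  then have "(\<Sum>m=1..4 ^ Suc K. 1 / real m) = (\<Sum>m=1..4 ^ K. 1 / real m) + (\<Sum>m=4^K+1..4 ^ Suc K. 1 / real m)"
    by (simp add: sum.union_disjoint)
  also have "(\<Sum>m=4^K+1..4 ^ Suc K. 1 / real m) \<le> (\<Sum>m=4^K+1..(4 ^ Suc K::nat). 1 / 4 ^ K)"
  proof (intro sum_mono divide_left_mono)
    fix m :: nat assume "m \<in> {4^K+1..4 ^ Suc K}"
    then have m: "4 ^ K \<le> m" by auto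
    then have "real (4 ^ K) \<le> real m" by (simp only: of_nat_le_iff)
    then show "4 ^ K \<le> real m" by simp
    have "(0::nat) < 4 ^ K" by simp
    then have "0 < m" using m by linarith
    then show "0 < real m * 4 ^ K" by simp
  qed auto
  also have "\<dots> = 3" by (simp add: field_simps of_nat_diff)
  finally show ?case using Suc by simp
qed simp

text \<open>
  Summation by parts: \<open>min \<bar>j\<bar> L\<close> counts the \<open>m \<le> L\<close> with \<open>m \<le> \<bar>j\<bar>\<close>, so the left-hand side is a sum
  of tails. It grows only logarithmically with the truncation \<open>4^K\<close>, hence linearly in \<open>K\<close>, which
  is less than the factor \<open>K\<^sup>2\<close> gained by the averaging.
\<close>

lemma truncated_first_moment_bound:
  fixes \<kappa> :: "int \<Rightarrow> real"
  assumes nn: "\<And>j. \<kappa> j \<ge> 0"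
    and tail: "\<And>m J :: nat. m \<ge> 1 \<Longrightarrow> (\<Sum>j\<in>{j \<in> {-int J..int J}. int m \<le> \<bar>j\<bar>}. \<kappa> j) \<le> C / real m"
  shows "(\<Sum>j\<in>{-int J..int J}. \<kappa> j * min \<bar>real_of_int j\<bar> (4 ^ K)) \<le> C * (3 * real K + 1)"
proof -
  have C: "C \<ge> 0" using order_trans[OF sum_nonneg tail[of 1 0]] nn by auto
  have min: "min \<bar>real_of_int j\<bar> (4 ^ K) = (\<Sum>m=1..4 ^ K. if int m \<le> \<bar>j\<bar> then 1 else 0)" for j
  proof -
    have "(\<Sum>m=1..(4::nat) ^ K. if int m \<le> \<bar>j\<bar> then 1 else 0 :: real) = real (card {m \<in> {1..4 ^ K}. int m \<le> \<bar>j\<bar>})"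
      by (subst sum.inter_filter[symmetric]) auto
    also have "{m \<in> {1..4 ^ K}. int m \<le> \<bar>j\<bar>} = {1..min (nat \<bar>j\<bar>) (4 ^ K)}" by auto
    finally have "(\<Sum>m=1..(4::nat) ^ K. if int m \<le> \<bar>j\<bar> then 1 else 0 :: real) = real (min (nat \<bar>j\<bar>) (4 ^ K))"
      by simp
    also have "\<dots> = min \<bar>real_of_int j\<bar> (4 ^ K)" by (simp add: of_nat_min)
    finally show ?thesis by simp
  qed
  have "(\<Sum>j\<in>{-int J..int J}. \<kappa> j * min \<bar>real_of_int j\<bar> (4 ^ K)) =
      (\<Sum>m=1..4 ^ K. \<Sum>j\<in>{-int J..int J}. if int m \<le> \<bar>j\<bar> then \<kappa> j else 0)"
    unfolding min sum_distrib_left by (subst sum.swap) (intro sum.cong, auto)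
  also have "\<dots> = (\<Sum>m=1..4 ^ K. \<Sum>j\<in>{j \<in> {-int J..int J}. int m \<le> \<bar>j\<bar>}. \<kappa> j)"
    by (intro sum.cong refl sum.inter_filter[symmetric]) simp
  also have "\<dots> \<le> (\<Sum>m=1..4 ^ K. C / real m)"
    using tail by (intro sum_mono) auto
  also have "\<dots> = C * (\<Sum>m=1..4 ^ K. 1 / real m)" by (simp add: sum_distrib_left)
  also have "\<dots> \<le> C * (3 * real K + 1)" using harmonic_sum_bound C by (rule mult_left_mono)
  finally show ?thesis .
qed

text \<open>
  The coefficients are \<open>t - s a\<close> with \<open>t\<close> the average of \<open>K\<close> tents, \<open>a\<close> the uniform probability on
  \<open>{1..M}\<close> and \<open>s\<close> the sum of \<open>t\<close>. As \<open>a 0 = 0\<close>, the value at the origin remains \<open>1\<close>. The parameters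
  are chosen in the order \<open>K\<close>, \<open>M\<close>, \<open>J\<close>, as \<open>s\<close> depends on \<open>K\<close> and the norm of \<open>c\<close> on both.
\<close>

lemma coefficients_with_small_variance:
  fixes \<kappa> :: "int \<Rightarrow> real"
  assumes nn: "\<And>j. \<kappa> j \<ge> 0"
    and tail: "\<And>m J :: nat. m \<ge> 1 \<Longrightarrow> (\<Sum>j\<in>{j \<in> {-int J..int J}. int m \<le> \<bar>j\<bar>}. \<kappa> j) \<le> C / real m"
    and total: "\<And>J :: nat. J \<ge> 1 \<Longrightarrow> v \<le> (\<Sum>j\<in>{-int J..int J}. \<kappa> j) + C / real J"
    and e: "e > 0"
  obtains c :: "int \<Rightarrow> real" and L :: nat where "c 0 = 1" "(\<Sum>n\<in>{-int L..int L}. c n) = 0"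
    "v * (\<Sum>n\<in>{-int L..int L}. (c n)\<^sup>2) - (\<Sum>n\<in>{-int L..int L}. \<Sum>m\<in>{-int L..int L}. c n * c m * \<kappa> (m - n)) < e"
proof -
  have C: "C \<ge> 0" using order_trans[OF sum_nonneg tail[of 1 0]] nn by auto
  have bounded_total: "(\<Sum>j\<in>{-int J..int J}. \<kappa> j) \<le> \<kappa> 0 + C" for J :: nat
  proof -
    have "{-int J..int J} = insert 0 {j \<in> {-int J..int J}. int 1 \<le> \<bar>j\<bar>}" by auto
    then have "(\<Sum>j\<in>{-int J..int J}. \<kappa> j) = \<kappa> 0 + (\<Sum>j\<in>{j \<in> {-int J..int J}. int 1 \<le> \<bar>j\<bar>}. \<kappa> j)"
      by (metis (mono_tags, lifting) abs_zero finite_atLeastAtMost_int finite_insert mem_Collect_eq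
          not_one_le_zero of_nat_1 sum.insert)
    then show ?thesis using tail[of 1 J] by simp
  qed
  define D where "D = \<kappa> 0 + C"
  have D: "D \<ge> 0" using C nn[of 0] by (simp add: D_def)
  obtain K0 :: nat where K0: "1024 * C / e < real K0" using reals_Archimedean2 by blast
  define K where "K = Suc K0"
  have K: "K > 0" "1024 * C < e * real K" using K0 e by (auto simp: K_def field_simps)
  define t where "t = tent_average K"
  define s where "s = (\<Sum>n\<in>{-(4^K)..4^K}. t n)"
  obtain M0 :: nat where M0: "16 * s\<^sup>2 * D / e < real M0" using reals_Archimedean2 by blast
  define M where "M = Suc M0"
  have M: "M > 0" "16 * s\<^sup>2 * D < e * real M" using M0 e by (auto simp: M_def field_simps)
  define a :: "int \<Rightarrow> real" where "a n = (if 1 \<le> n \<and> n \<le> int M then 1 / real M else 0)" for n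
  define c where "c n = t n - s * a n" for n
  define L where "L = max (4 ^ K) M"
  have L: "4 ^ K \<le> int L" "int M \<le> int L" by (auto simp: L_def)
  have t0: "t n = 0" if "\<bar>n\<bar> > 4 ^ K" for n using tent_average_support that by (simp add: t_def)
  have a0: "a n = 0" if "\<bar>n\<bar> > int L" for n using that L by (auto simp: a_def)
  have c0: "c n = 0" if "\<bar>n\<bar> > int L" for n
    using a0[OF that] t0[OF le_less_trans[OF L(1) that]] by (simp add: c_def)
  have sum_a: "(\<Sum>n\<in>{-int L..int L}. a n) = 1"
  proof -
    have "(\<Sum>n\<in>{-int L..int L}. a n) = (\<Sum>n\<in>{1..int M}. a n)"
      using L by (intro sum.mono_neutral_right) (auto simp: a_def)
    also have "\<dots> = (\<Sum>n\<in>{1..int M}. 1 / real M)" by (intro sum.cong) (auto simp: a_def)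
    finally show ?thesis using M by simp
  qed
  have sum_a2: "(\<Sum>n\<in>{-int L..int L}. (a n)\<^sup>2) = 1 / real M"
  proof -
    have "(\<Sum>n\<in>{-int L..int L}. (a n)\<^sup>2) = (\<Sum>n\<in>{-int L..int L}. a n / real M)"
      by (intro sum.cong) (auto simp: a_def power2_eq_square)
    then show ?thesis using sum_a by (simp add: sum_divide_distrib[symmetric])
  qed
  have sum_t: "(\<Sum>n\<in>{-int L..int L}. t n) = s"
    unfolding s_def using t0 L by (intro sum.mono_neutral_right) auto
  define N where "N = (\<Sum>n\<in>{-int L..int L}. (c n)\<^sup>2)"
  have N: "N \<ge> 0" by (simp add: N_def sum_nonneg)
  obtain J0 :: nat where J0: "4 * N * C / e < real J0" using reals_Archimedean2 by blast
  define J where "J = max (Suc J0) (2 * L)"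
  have J: "J \<ge> 1" "4 * N * C < e * real J" "2 * int L \<le> int J"
  proof -
    have "4 * N * C / e < real J" using J0 by (simp add: J_def)
    then show "4 * N * C < e * real J" using e by (simp add: field_simps)
  qed (auto simp: J_def)
  let ?W = "{-(int L + int J)..int L + int J}"
  have inc: "(\<Sum>n\<in>?W. (c (n + j) - c n)\<^sup>2) \<le>
      128 / (real K)\<^sup>2 * min \<bar>real_of_int j\<bar> (4 ^ K) + 8 * s\<^sup>2 / real M" if j: "j \<in> {-int J..int J}" for j
  proof -
    have p: "(x + y)\<^sup>2 \<le> 2 * x\<^sup>2 + 2 * y\<^sup>2" for x y :: real
      using zero_le_power2[of "x - y"] by (simp add: power2_eq_square algebra_simps)
    have "(a (n + j) - a n)\<^sup>2 \<le> 2 * (a (n + j))\<^sup>2 + 2 * (a n)\<^sup>2" for n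
      using p[of "a (n + j)" "- a n"] by simp
    then have "(\<Sum>n\<in>?W. (a (n + j) - a n)\<^sup>2) \<le> 2 * (\<Sum>n\<in>?W. (a (n + j))\<^sup>2) + 2 * (\<Sum>n\<in>?W. (a (n + 0))\<^sup>2)"
      by (simp add: sum_distrib_left sum.distrib[symmetric] sum_mono)
    also have "\<dots> = 4 / real M"
      using sum_shift_window[of "int L" "\<lambda>n. (a n)\<^sup>2" j "int L + int J"]
        sum_shift_window[of "int L" "\<lambda>n. (a n)\<^sup>2" 0 "int L + int J"] a0 j sum_a2 by auto
    finally have A: "(\<Sum>n\<in>?W. (a (n + j) - a n)\<^sup>2) \<le> 4 / real M" .
    have T: "(\<Sum>n\<in>?W. (t (n + j) - t n)\<^sup>2) \<le> 64 / (real K)\<^sup>2 * min \<bar>real_of_int j\<bar> (4 ^ K)"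
      unfolding t_def by (rule tent_average_increment) (use K in auto)
    have "(c (n + j) - c n)\<^sup>2 \<le> 2 * (t (n + j) - t n)\<^sup>2 + 2 * s\<^sup>2 * (a (n + j) - a n)\<^sup>2" for n
    proof -
      have "c (n + j) - c n = (t (n + j) - t n) + - (s * (a (n + j) - a n))"
        by (simp add: c_def algebra_simps)
      then show ?thesis
        using p[of "t (n + j) - t n" "- (s * (a (n + j) - a n))"] by (simp add: power_mult_distrib)
    qed
    then have "(\<Sum>n\<in>?W. (c (n + j) - c n)\<^sup>2) \<le>
        2 * (\<Sum>n\<in>?W. (t (n + j) - t n)\<^sup>2) + 2 * s\<^sup>2 * (\<Sum>n\<in>?W. (a (n + j) - a n)\<^sup>2)"
      by (simp add: sum_distrib_left sum.distrib[symmetric] sum_mono)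
    also have "\<dots> \<le> 2 * (64 / (real K)\<^sup>2 * min \<bar>real_of_int j\<bar> (4 ^ K)) + 2 * s\<^sup>2 * (4 / real M)"
      using A T by (intro add_mono mult_left_mono) auto
    finally show ?thesis by simp
  qed
  have "(\<Sum>j\<in>{-int J..int J}. \<kappa> j * (\<Sum>n\<in>?W. (c (n + j) - c n)\<^sup>2)) \<le>
      (\<Sum>j\<in>{-int J..int J}. \<kappa> j * (128 / (real K)\<^sup>2 * min \<bar>real_of_int j\<bar> (4 ^ K) + 8 * s\<^sup>2 / real M))"
    using inc nn by (intro sum_mono mult_left_mono) auto
  also have "\<dots> = 128 / (real K)\<^sup>2 * (\<Sum>j\<in>{-int J..int J}. \<kappa> j * min \<bar>real_of_int j\<bar> (4 ^ K))
      + 8 * s\<^sup>2 / real M * (\<Sum>j\<in>{-int J..int J}. \<kappa> j)"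
    unfolding sum_distrib_left sum.distrib[symmetric] by (intro sum.cong refl) (simp only: algebra_simps)
  also have "\<dots> \<le> 128 / (real K)\<^sup>2 * (C * (3 * real K + 1)) + 8 * s\<^sup>2 / real M * D"
    using truncated_first_moment_bound[OF nn tail] bounded_total[of J]
    by (intro add_mono mult_left_mono) (auto simp: D_def)
  also have "128 / (real K)\<^sup>2 * (C * (3 * real K + 1)) \<le> 128 / (real K)\<^sup>2 * (C * (4 * real K))"
    using C K by (intro mult_left_mono) auto
  also have "\<dots> = 512 * C / real K" using K by (simp add: power2_eq_square)
  also have "512 * C / real K < e / 2" using K by (simp add: field_simps)
  also have "8 * s\<^sup>2 / real M * D < e / 2" using M by (simp add: field_simps)
  finally have 1: "(\<Sum>j\<in>{-int J..int J}. \<kappa> j * (\<Sum>n\<in>?W. (c (n + j) - c n)\<^sup>2)) < e" by simp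
  have "N * (v - (\<Sum>j\<in>{-int J..int J}. \<kappa> j)) \<le> N * (C / real J)"
    using total[of J] J N by (intro mult_left_mono) auto
  also have "\<dots> < e / 4" using J by (simp add: field_simps)
  finally have 2: "N * (v - (\<Sum>j\<in>{-int J..int J}. \<kappa> j)) < e / 4" .
  have Q: "v * N - (\<Sum>n\<in>{-int L..int L}. \<Sum>m\<in>{-int L..int L}. c n * c m * \<kappa> (m - n)) < e"
    using quadratic_form_via_increments[of "int L" c "int J" v \<kappa>] c0 J 1 2 e unfolding N_def by simp
  show ?thesis
  proof (rule that[of c L])
    show "c 0 = 1" using tent_average_0[of K] K by (simp add: c_def a_def t_def)
    show "(\<Sum>n\<in>{-int L..int L}. c n) = 0"
      using sum_a sum_t by (simp add: c_def sum_subtractf sum_distrib_left[symmetric])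
  qed (use Q in \<open>simp add: N_def\<close>)
qed

section \<open>Fourier transform of an indicator and Plancherel\<close>

abbreviation spectral_kernel :: "real set \<Rightarrow> real \<Rightarrow> real" where
  "spectral_kernel B t \<equiv> (cmod (fourier_transform (indicator B) t))\<^sup>2"

lemma fourier_transform_measurable [measurable]:
  fixes f :: "real \<Rightarrow> complex"
  assumes [measurable]: "f \<in> borel_measurable borel"
  shows "fourier_transform f \<in> borel_measurable borel"
  unfolding fourier_transform_def by measurable

text \<open>
  The finite measure with density \<open>\<chi>\<^sub>B\<close> brings in the integration theory of bounded functions on finite
  measure spaces.
\<close>

lemma fourier_indicator_eq:
  fixes B :: "real set"
  assumes [measurable]: "B \<in> sets borel"
  shows "fourier_transform (indicator B) \<xi> =
    (LINT x|density lborel (indicator B). exp (- (\<i> * of_real (2 * pi * (x * \<xi>)))))"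
proof -
  have "(LINT x|density lborel (\<lambda>x. ennreal (indicator B x)). exp (- (\<i> * of_real (2 * pi * (x * \<xi>))))) =
      (LINT x|lborel. (indicator B x :: real) *\<^sub>R exp (- (\<i> * of_real (2 * pi * (x * \<xi>)))))"
    by (rule integral_density; measurable?; simp)
  moreover have "(indicator B x :: real) *\<^sub>R z = indicator B x * z" for x and z :: complex
    by (simp add: indicator_def)
  ultimately show ?thesis by (simp add: fourier_transform_def ennreal_indicator inner_real_def del: of_real_mult)
qed

lemma finite_measure_bounded_density:
  fixes B :: "real set"
  assumes "B \<in> sets borel" "bounded B"
  shows "finite_measure (density lborel (indicator B :: real \<Rightarrow> ennreal))"
    "measure (density lborel (indicator B)) UNIV = measure lborel B"
proof -
  have e: "emeasure (density lborel (indicator B)) UNIV = emeasure lborel B"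
    using assms by (subst emeasure_density) auto
  then show "finite_measure (density lborel (indicator B :: real \<Rightarrow> ennreal))"
    using emeasure_bounded_finite[OF assms(2)] by (intro finite_measureI) auto
  show "measure (density lborel (indicator B)) UNIV = measure lborel B"
    using e by (simp add: measure_def)
qed

lemma
  fixes B :: "real set"
  assumes B: "B \<in> sets borel" "bounded B"
  shows fourier_indicator_bound: "cmod (fourier_transform (indicator B) \<xi>) \<le> measure lborel B"
    and fourier_indicator_0: "fourier_transform (indicator B) (0::real) = of_real (measure lborel B)"
    and fourier_indicator_minus: "fourier_transform (indicator B) (-\<xi>) = cnj (fourier_transform (indicator B) \<xi>)"
proof -
  let ?M = "density lborel (indicator B :: real \<Rightarrow> ennreal)"
  interpret finite_measure ?M by (rule finite_measure_bounded_density[OF B])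
  have M: "measure ?M UNIV = measure lborel B" by (rule finite_measure_bounded_density[OF B])
  have "cmod (LINT x|?M. exp (- (\<i> * of_real (2 * pi * (x * \<xi>))))) \<le> (LINT x|?M. cmod (exp (- (\<i> * of_real (2 * pi * (x * \<xi>))))))"
    by (rule integral_norm_bound)
  then show "cmod (fourier_transform (indicator B) \<xi>) \<le> measure lborel B"
    unfolding fourier_indicator_eq[OF B(1)] by (simp add: M)
  show "fourier_transform (indicator B) (0::real) = of_real (measure lborel B)"
    unfolding fourier_indicator_eq[OF B(1)] by (simp add: M of_real_def)
  show "fourier_transform (indicator B) (-\<xi>) = cnj (fourier_transform (indicator B) \<xi>)"
    unfolding fourier_indicator_eq[OF B(1)] Bochner_Integration.integral_cnj[symmetric] by (simp add: exp_cnj del: Bochner_Integration.integral_cnj)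
qed

text \<open>
  Continuity at \<open>0\<close> of the autocorrelation of \<open>\<chi>\<^sub>B\<close>. By regularity \<open>B\<close> is almost a compact set \<open>C\<close>,
  which lies in an open set \<open>U\<close> of almost the same measure; small translates of \<open>C\<close> stay inside \<open>U\<close> and
  so must almost coincide with \<open>C\<close>.
\<close>

lemma overlap_near_zero:
  fixes B :: "real set"
  assumes B: "B \<in> sets borel" "bounded B" and e: "e > 0"
  obtains d where "d > 0" "\<And>t. \<bar>t\<bar> < d \<Longrightarrow> measure lborel {y \<in> B. y + t \<in> B} \<ge> measure lborel B - e"
proof -
  have BL: "B \<in> sets lebesgue" using B by simp
  obtain C where C: "closed C" "C \<subseteq> B" "emeasure lebesgue (B - C) < ennreal (e/2)"
    using sets_lebesgue_inner_closed[OF BL half_gt_zero[OF e]] by metis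
  have Cb: "compact C" using C(1) bounded_subset[OF B(2) C(2)] by (simp add: compact_eq_bounded_closed)
  have CL: "C \<in> sets lebesgue" using C by auto
  obtain U where U: "open U" "C \<subseteq> U" "emeasure lebesgue (U - C) < ennreal (e/2)"
    using sets_lebesgue_outer_open[OF CL half_gt_zero[OF e]] by metis
  have m [measurable]: "C \<in> sets borel" "U \<in> sets borel" "B \<in> sets borel" using C U B by auto
  have fin: "emeasure lborel B < \<infinity>" "emeasure lborel C < \<infinity>"
    using emeasure_bounded_finite[OF B(2)] emeasure_bounded_finite[OF compact_imp_bounded[OF Cb]] by auto
  have BC: "measure lborel B - measure lborel C \<le> e / 2"
  proof -
    have "measure lborel B = measure lborel C + measure lborel (B - C)"
      using C fin by (subst measure_Un2[symmetric]) (auto simp: fmeasurable_def Un_absorb1 Diff_partition)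
    moreover have "measure lborel (B - C) \<le> e / 2"
      unfolding measure_def using C(3) e m by (intro enn2real_leI) (auto intro: less_imp_le)
    ultimately show ?thesis by simp
  qed
  have UC: "emeasure lborel (U - C) < ennreal (e/2)" using U(3) m by simp
  show ?thesis
  proof (cases "C = {}")
    case True
    show ?thesis
    proof (rule that[of 1])
      fix t :: real
      have "measure lborel B - e \<le> 0" using BC True e by simp
      then show "measure lborel B - e \<le> measure lborel {y \<in> B. y + t \<in> B}"
        using measure_nonneg order_trans by blast
    qed simp
  next
    case False
    obtain d where d: "d > 0" "{x. infdist x C \<le> d} \<subseteq> U"
      using compact_in_open_separated[OF False Cb U(1,2)] by blast
    show ?thesis
    proof (rule that[OF d(1)])
      fix t :: real assume t: "\<bar>t\<bar> < d"
      let ?D = "{y. y + t \<in> C}"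
      have [measurable]: "?D \<in> sets borel" by measurable
      have DU: "?D \<subseteq> U"
      proof
        fix y assume "y \<in> ?D"
        then have "infdist y C \<le> dist y (y + t)" by (intro infdist_le) auto
        then show "y \<in> U" using d t by (auto simp: dist_real_def)
      qed
      have D: "emeasure lborel ?D = emeasure lborel C"
      proof -
        have "emeasure lborel C = (\<integral>\<^sup>+y. indicator C y \<partial>lborel)" by simp
        also have "\<dots> = (\<integral>\<^sup>+y. indicator C (t + 1 * y) \<partial>lborel)"
          by (subst nn_integral_real_affine[where t = t and c = 1]) auto
        also have "\<dots> = (\<integral>\<^sup>+y. indicator ?D y \<partial>lborel)"
          by (intro nn_integral_cong) (auto simp: indicator_def add.commute)
        finally show ?thesis by simp
      qed
      \<comment> \<open>\<open>C - t\<close> sticks out of \<open>C\<close> only inside \<open>U - C\<close>.\<close>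
      have "measure lborel ?D \<le> measure lborel (C \<inter> ?D) + measure lborel (?D - C)"
      proof -
        have "?D = (C \<inter> ?D) \<union> (?D - C)" by auto
        then show ?thesis
          using measure_Un_le[of "C \<inter> ?D" lborel "?D - C"] by simp
      qed
      also have "measure lborel (?D - C) \<le> e / 2"
      proof -
        have "emeasure lborel (?D - C) \<le> emeasure lborel (U - C)"
          using DU by (intro emeasure_mono) auto
        then have "emeasure lborel (?D - C) \<le> ennreal (e/2)" using UC by (simp add: le_less_trans less_imp_le)
        then show ?thesis unfolding measure_def using e by (intro enn2real_leI) auto
      qed
      also have "measure lborel (C \<inter> ?D) \<le> measure lborel {y \<in> B. y + t \<in> B}"
      proof (rule measure_mono_fmeasurable)
        show "{y \<in> B. y + t \<in> B} \<in> fmeasurable lborel"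
        proof (rule fmeasurableI2[of B])
          show "B \<in> fmeasurable lborel" using fin m by (intro fmeasurableI) auto
        qed auto
      qed (use C in auto)
      finally have "measure lborel ?D \<le> measure lborel {y \<in> B. y + t \<in> B} + e / 2" by simp
      moreover have "measure lborel ?D = measure lborel C" using D by (simp add: measure_def)
      ultimately show "measure lborel B - e \<le> measure lborel {y \<in> B. y + t \<in> B}" using BC by linarith
    qed
  qed
qed

text \<open>
  Expanding \<open>k\<close> as a double integral over \<open>B \<times> B\<close> and integrating first over the Gaussian variable
  leaves the characteristic function of the normal distribution. The Gaussian weight makes everything
  absolutely integrable.
\<close>

lemma gaussian_average_of_kernel:
  fixes B :: "real set" and a :: real
  assumes B: "B \<in> sets borel" "bounded B"
  defines "M \<equiv> density lborel (indicator B :: real \<Rightarrow> ennreal)"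
  shows "(LINT s|std_normal_distribution. spectral_kernel B (a * s)) =
    (LINT z|(M \<Otimes>\<^sub>M M). exp (- (2 * pi * a * (snd z - fst z))\<^sup>2 / 2))"
proof -
  interpret M: finite_measure M unfolding M_def by (rule finite_measure_bounded_density[OF B])
  interpret MM: finite_measure "M \<Otimes>\<^sub>M M" by (rule finite_measure_pair_measure) unfold_locales
  interpret G: real_distribution std_normal_distribution by (rule real_dist_normal_dist)
  interpret P: pair_sigma_finite M M ..
  interpret Q: pair_sigma_finite std_normal_distribution "M \<Otimes>\<^sub>M M" ..
  interpret QF: finite_measure "std_normal_distribution \<Otimes>\<^sub>M (M \<Otimes>\<^sub>M M)"
    by (rule finite_measure_pair_measure) unfold_locales
  have setsM [measurable_cong]: "sets M = sets borel" by (simp add: M_def)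
  let ?h = "\<lambda>s z. iexp ((2 * pi * a * (snd z - fst z)) * s)"
  have k: "complex_of_real (spectral_kernel B (a * s)) = (LINT z|(M \<Otimes>\<^sub>M M). ?h s z)" for s
  proof -
    let ?f = "\<lambda>x. exp (- (\<i> * of_real (2 * pi * (x * (a * s)))))"
    have I: "integrable (M \<Otimes>\<^sub>M M) (\<lambda>z. ?f (fst z) * cnj (?f (snd z)))"
      by (rule MM.integrable_const_bound[of _ 1]) (auto simp: norm_mult exp_cnj)
    have "complex_of_real (spectral_kernel B (a * s)) =
      fourier_transform (indicator B) (a * s) * cnj (fourier_transform (indicator B) (a * s))"
      by (rule complex_norm_square)
    also have "\<dots> = (LINT x|M. ?f x) * (LINT y|M. cnj (?f y))"
      unfolding fourier_indicator_eq[OF B(1)] M_def[symmetric] Bochner_Integration.integral_cnj ..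
    also have "\<dots> = (LINT x|M. (LINT y|M. ?f x * cnj (?f y)))"
      by (simp only: integral_mult_right_zero integral_mult_left_zero)
    also have "\<dots> = (LINT z|(M \<Otimes>\<^sub>M M). ?f (fst z) * cnj (?f (snd z)))"
      using P.integral_fst'[OF I] by simp
    also have "\<dots> = (LINT z|(M \<Otimes>\<^sub>M M). ?h s z)"
      by (intro Bochner_Integration.integral_cong refl) (simp add: exp_cnj exp_add[symmetric] algebra_simps)
    finally show ?thesis .
  qed
  have I2: "integrable (std_normal_distribution \<Otimes>\<^sub>M (M \<Otimes>\<^sub>M M)) (case_prod ?h)"
    by (rule QF.integrable_const_bound[of _ 1]) (auto simp: split_beta)
  have "complex_of_real (LINT s|std_normal_distribution. spectral_kernel B (a * s)) =
      (LINT s|std_normal_distribution. LINT z|(M \<Otimes>\<^sub>M M). ?h s z)"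
    unfolding k[symmetric] by (rule integral_complex_of_real[symmetric])
  also have "\<dots> = (LINT z|(M \<Otimes>\<^sub>M M). char std_normal_distribution (2 * pi * a * (snd z - fst z)))"
    unfolding char_def by (rule Q.Fubini_integral[OF I2, symmetric])
  also have "\<dots> = complex_of_real (LINT z|(M \<Otimes>\<^sub>M M). exp (- (2 * pi * a * (snd z - fst z))\<^sup>2 / 2))"
    unfolding char_std_normal_distribution by simp
  finally show ?thesis unfolding of_real_eq_iff .
qed


text \<open>
  The Gaussian average of \<open>k(a s)\<close>, multiplied by \<open>a * sqrt (2 * pi)\<close>, is at most the integral of
  \<open>k\<close>, because the normal density never exceeds \<open>1 / sqrt (2 * pi)\<close>. Substituting
  \<open>y = x + u / (2 * pi * a)\<close> in the double integral over \<open>B \<times> B\<close> turns its kernel into a normal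
  density in \<open>u\<close> again; all normalising factors cancel.
\<close>

lemma kernel_integral_ge_average_overlap:
  fixes B :: "real set" and a :: real
  assumes B: "B \<in> sets borel" "bounded B" and a: "a > 0"
  shows "(\<integral>\<^sup>+u. ennreal (measure lborel {y \<in> B. y + u / (2 * pi * a) \<in> B}) \<partial>std_normal_distribution) \<le>
    (\<integral>\<^sup>+t. ennreal (spectral_kernel B t) \<partial>lborel)"
proof -
  define M where "M = density lborel (indicator B :: real \<Rightarrow> ennreal)"
  define b where "b = 2 * pi * a"
  have b: "b > 0" using a by (simp add: b_def)
  note [measurable] = B(1)
  interpret M: finite_measure M unfolding M_def by (rule finite_measure_bounded_density[OF B])
  interpret MM: finite_measure "M \<Otimes>\<^sub>M M" by (rule finite_measure_pair_measure) unfold_locales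
  interpret G: real_distribution std_normal_distribution by (rule real_dist_normal_dist)
  interpret P: pair_sigma_finite M M ..
  have setsM [measurable_cong]: "sets M = sets borel" by (simp add: M_def)
  let ?k = "spectral_kernel B"
  let ?I = "\<integral>\<^sup>+t. ennreal (?k t) \<partial>lborel"
  have k_le: "?k t \<le> (measure lborel B)\<^sup>2" for t
    using fourier_indicator_bound[OF B] by (intro power_mono) auto
  have [measurable]: "fourier_transform (indicator B :: real \<Rightarrow> complex) \<in> borel_measurable borel"
    by measurable
  have gauss: "ennreal (LINT s|std_normal_distribution. ?k (a * s)) * ennreal (sqrt (2 * pi)) * ennreal a \<le> ?I"
  proof -
    have "integrable std_normal_distribution (\<lambda>s. ?k (a * s))"
      by (rule G.integrable_const_bound[of _ "(measure lborel B)\<^sup>2"]) (use k_le in auto)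
    then have "ennreal (LINT s|std_normal_distribution. ?k (a * s)) = (\<integral>\<^sup>+s. ennreal (?k (a * s)) \<partial>std_normal_distribution)"
      by (intro nn_integral_eq_integral[symmetric]) auto
    also have "\<dots> = (\<integral>\<^sup>+s. ennreal (std_normal_density s) * ennreal (?k (a * s)) \<partial>lborel)"
      by (subst nn_integral_density) auto
    also have "\<dots> \<le> (\<integral>\<^sup>+s. ennreal (1 / sqrt (2 * pi)) * ennreal (?k (a * s)) \<partial>lborel)"
      by (intro nn_integral_mono mult_right_mono ennreal_leI) (auto simp: std_normal_density_def divide_simps)
    also have "\<dots> = ennreal (1 / sqrt (2 * pi)) * (\<integral>\<^sup>+s. ennreal (?k (a * s)) \<partial>lborel)"
      by (rule nn_integral_cmult) measurable
    finally have "ennreal (LINT s|std_normal_distribution. ?k (a * s)) * (ennreal (sqrt (2 * pi)) * ennreal a) \<le>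
        (ennreal (1 / sqrt (2 * pi)) * (\<integral>\<^sup>+s. ennreal (?k (a * s)) \<partial>lborel)) * (ennreal (sqrt (2 * pi)) * ennreal a)"
      by (rule mult_right_mono) simp
    also have "\<dots> = (ennreal (1 / sqrt (2 * pi)) * ennreal (sqrt (2 * pi))) * (ennreal a * (\<integral>\<^sup>+s. ennreal (?k (a * s)) \<partial>lborel))"
      by (simp only: ac_simps)
    also have "ennreal (1 / sqrt (2 * pi)) * ennreal (sqrt (2 * pi)) = 1"
      by (subst ennreal_mult[symmetric]) auto
    also have "ennreal a * (\<integral>\<^sup>+s. ennreal (?k (a * s)) \<partial>lborel) = ?I"
      using a by (subst (2) nn_integral_real_affine[where t = 0 and c = a]) auto
    finally show ?thesis by (simp add: mult.assoc)
  qed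
  let ?E = "\<lambda>x y. exp (- (2 * pi * a * (y - x))\<^sup>2 / 2)"
  have G: "ennreal (measure lborel {y \<in> B. y + t \<in> B}) = (\<integral>\<^sup>+x. indicator B x * indicator B (x + t) \<partial>lborel)" for t
  proof -
    have "emeasure lborel {y \<in> B. y + t \<in> B} < \<infinity>"
      using bounded_subset[OF B(2)] by (intro emeasure_bounded_finite) auto
    then have "ennreal (measure lborel {y \<in> B. y + t \<in> B}) = emeasure lborel {y \<in> B. y + t \<in> B}"
      by (simp add: emeasure_eq_ennreal_measure)
    also have "\<dots> = (\<integral>\<^sup>+x. indicator {y \<in> B. y + t \<in> B} x \<partial>lborel)"
      by (intro nn_integral_indicator[symmetric]) measurable
    also have "\<dots> = (\<integral>\<^sup>+x. indicator B x * indicator B (x + t) \<partial>lborel)"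
      by (intro nn_integral_cong) (auto simp: indicator_def)
    finally show ?thesis .
  qed
  have "ennreal (LINT z|(M \<Otimes>\<^sub>M M). ?E (fst z) (snd z)) = (\<integral>\<^sup>+z. ennreal (?E (fst z) (snd z)) \<partial>(M \<Otimes>\<^sub>M M))"
    by (intro nn_integral_eq_integral[symmetric] MM.integrable_const_bound[of _ 1]) auto
  also have "\<dots> = (\<integral>\<^sup>+x. \<integral>\<^sup>+y. ennreal (?E x y) \<partial>M \<partial>M)"
    by (subst M.nn_integral_fst[symmetric]) auto
  also have "\<dots> = (\<integral>\<^sup>+x. indicator B x * (\<integral>\<^sup>+y. indicator B y * ennreal (?E x y) \<partial>lborel) \<partial>lborel)"
    unfolding M_def by (simp add: nn_integral_density)
  also have "\<dots> = (\<integral>\<^sup>+x. ennreal (1 / b) * (\<integral>\<^sup>+u. indicator B x * indicator B (x + u / b) * ennreal (exp (- u\<^sup>2 / 2)) \<partial>lborel) \<partial>lborel)"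
  proof (rule nn_integral_cong)
    fix x :: real
    have "(\<integral>\<^sup>+y. indicator B y * ennreal (?E x y) \<partial>lborel) =
        ennreal (1 / b) * (\<integral>\<^sup>+u. indicator B (x + u / b) * ennreal (exp (- u\<^sup>2 / 2)) \<partial>lborel)"
      using b by (subst nn_integral_real_affine[where t = x and c = "1 / b"]) (auto simp: b_def[symmetric])
    moreover have "(\<integral>\<^sup>+u. indicator B x * indicator B (x + u / b) * ennreal (exp (- u\<^sup>2 / 2)) \<partial>lborel) =
        indicator B x * (\<integral>\<^sup>+u. indicator B (x + u / b) * ennreal (exp (- u\<^sup>2 / 2)) \<partial>lborel)"
      unfolding mult.assoc by (rule nn_integral_cmult) measurable
    ultimately show "indicator B x * (\<integral>\<^sup>+y. indicator B y * ennreal (?E x y) \<partial>lborel) =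
      ennreal (1 / b) * (\<integral>\<^sup>+u. indicator B x * indicator B (x + u / b) * ennreal (exp (- u\<^sup>2 / 2)) \<partial>lborel)"
      by (simp only: ac_simps)
  qed
  also have "\<dots> = ennreal (1 / b) * (\<integral>\<^sup>+x. \<integral>\<^sup>+u. indicator B x * indicator B (x + u / b) * ennreal (exp (- u\<^sup>2 / 2)) \<partial>lborel \<partial>lborel)"
    by (rule nn_integral_cmult) measurable
  also have "(\<integral>\<^sup>+x. \<integral>\<^sup>+u. indicator B x * indicator B (x + u / b) * ennreal (exp (- u\<^sup>2 / 2)) \<partial>lborel \<partial>lborel) =
      (\<integral>\<^sup>+u. \<integral>\<^sup>+x. indicator B x * indicator B (x + u / b) * ennreal (exp (- u\<^sup>2 / 2)) \<partial>lborel \<partial>lborel)"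
    by (rule lborel_pair.Fubini') measurable
  also have "\<dots> = (\<integral>\<^sup>+u. ennreal (measure lborel {y \<in> B. y + u / b \<in> B}) * ennreal (exp (- u\<^sup>2 / 2)) \<partial>lborel)"
    unfolding G by (intro nn_integral_cong nn_integral_multc) measurable
  also have "\<dots> = (\<integral>\<^sup>+u. ennreal (sqrt (2 * pi)) * (ennreal (std_normal_density u) * ennreal (measure lborel {y \<in> B. y + u / b \<in> B})) \<partial>lborel)"
  proof (rule nn_integral_cong)
    fix u :: real
    have "ennreal (exp (- u\<^sup>2 / 2)) = ennreal (sqrt (2 * pi)) * ennreal (std_normal_density u)"
      by (subst ennreal_mult[symmetric]) (auto simp: std_normal_density_def)
    then show "ennreal (measure lborel {y \<in> B. y + u / b \<in> B}) * ennreal (exp (- u\<^sup>2 / 2)) =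
      ennreal (sqrt (2 * pi)) * (ennreal (std_normal_density u) * ennreal (measure lborel {y \<in> B. y + u / b \<in> B}))"
      by (simp only: ac_simps)
  qed
  also have "\<dots> = ennreal (sqrt (2 * pi)) * (\<integral>\<^sup>+u. ennreal (std_normal_density u) * ennreal (measure lborel {y \<in> B. y + u / b \<in> B}) \<partial>lborel)"
    unfolding G by (rule nn_integral_cmult) measurable
  also have "(\<integral>\<^sup>+u. ennreal (std_normal_density u) * ennreal (measure lborel {y \<in> B. y + u / b \<in> B}) \<partial>lborel) =
      (\<integral>\<^sup>+u. ennreal (measure lborel {y \<in> B. y + u / b \<in> B}) \<partial>std_normal_distribution)"
    unfolding G by (rule nn_integral_density[symmetric]) measurable
  finally have E: "ennreal (LINT z|(M \<Otimes>\<^sub>M M). ?E (fst z) (snd z)) =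
    ennreal (1 / b) * (ennreal (sqrt (2 * pi)) * (\<integral>\<^sup>+u. ennreal (measure lborel {y \<in> B. y + u / b \<in> B}) \<partial>std_normal_distribution))" .
  have cancel: "ennreal (1 / b) * (ennreal (sqrt (2 * pi)) * X) * ennreal (sqrt (2 * pi)) * ennreal a = X" for X
  proof -
    have "ennreal (1 / b) * (ennreal (sqrt (2 * pi)) * (ennreal (sqrt (2 * pi)) * ennreal a)) = ennreal (1 / b * (sqrt (2 * pi) * (sqrt (2 * pi) * a)))"
    proof -
      have "0 \<le> 1 / b" "0 \<le> sqrt (2 * pi)" "0 \<le> a" using a b by auto
      then show ?thesis by (simp only: ennreal_mult mult_nonneg_nonneg)
    qed
    also have "1 / b * (sqrt (2 * pi) * (sqrt (2 * pi) * a)) = 1"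
      using a by (simp add: b_def)
    finally show ?thesis by (simp add: ac_simps)
  qed
  show ?thesis
    using gauss unfolding gaussian_average_of_kernel[OF B] M_def[symmetric] E cancel unfolding b_def .
qed

text \<open>
  The bound by the average overlap holds for every \<open>a\<close>; as \<open>a\<close> grows the translations
  \<open>u / (2 * pi * a)\<close> tend to \<open>0\<close> and the overlap tends to the whole measure of \<open>B\<close>.
\<close>

lemma plancherel_lower_bound:
  fixes B :: "real set"
  assumes B: "B \<in> sets borel" "bounded B"
  shows "ennreal (measure lborel B) \<le> (\<integral>\<^sup>+t. ennreal (spectral_kernel B t) \<partial>lborel)"
proof -
  note [measurable] = B(1)
  interpret G: real_distribution std_normal_distribution by (rule real_dist_normal_dist)
  define g where "g t = measure lborel {y \<in> B. y + t \<in> B}" for t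
  have fin: "B \<in> fmeasurable lborel"
    using B emeasure_bounded_finite by (intro fmeasurableI) auto
  have g_le: "g t \<le> measure lborel B" for t
    unfolding g_def using fin by (intro measure_mono_fmeasurable) auto
  have g_measurable [measurable]: "g \<in> borel_measurable borel"
    unfolding g_def by measurable
  have int: "integrable std_normal_distribution (\<lambda>u. g (u / c))" for c
    by (rule G.integrable_const_bound[of _ "measure lborel B"]) (use g_le in \<open>auto simp: g_def\<close>)
  have lim: "(\<lambda>n. g (u / (2 * pi * real (Suc n)))) \<longlonglongrightarrow> measure lborel B" for u
  proof (rule LIMSEQ_I)
    fix e :: real assume e: "e > 0"
    obtain d where d: "d > 0" "\<And>t. \<bar>t\<bar> < d \<Longrightarrow> measure lborel {y \<in> B. y + t \<in> B} \<ge> measure lborel B - e / 2"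
      using overlap_near_zero[OF B half_gt_zero[OF e]] by metis
    have "(\<lambda>n. u / (2 * pi) * inverse (real (Suc n))) \<longlonglongrightarrow> u / (2 * pi) * 0"
      by (intro tendsto_mult tendsto_const LIMSEQ_inverse_real_of_nat)
    then have "\<exists>N. \<forall>n\<ge>N. norm (u / (2 * pi) * inverse (real (Suc n)) - u / (2 * pi) * 0) < d"
      by (rule LIMSEQ_D[OF _ d(1)])
    then obtain N where N: "\<forall>n\<ge>N. norm (u / (2 * pi) * inverse (real (Suc n)) - u / (2 * pi) * 0) < d" ..
    show "\<exists>N. \<forall>n\<ge>N. norm (g (u / (2 * pi * real (Suc n))) - measure lborel B) < e"
    proof (intro exI allI impI)
      fix n assume "n \<ge> N"
      then have "norm (u / (2 * pi) * inverse (real (Suc n)) - u / (2 * pi) * 0) < d" using N by simp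
      then have "\<bar>u / (2 * pi * real (Suc n))\<bar> < d"
        by (simp only: mult_zero_right diff_zero divide_inverse inverse_mult_distrib mult.assoc real_norm_def)
      then have "g (u / (2 * pi * real (Suc n))) \<ge> measure lborel B - e / 2"
        unfolding g_def by (rule d(2))
      then show "norm (g (u / (2 * pi * real (Suc n))) - measure lborel B) < e"
        using g_le[of "u / (2 * pi * real (Suc n))"] e by simp
    qed
  qed
  have "(\<lambda>n. LINT u|std_normal_distribution. g (u / (2 * pi * real (Suc n)))) \<longlonglongrightarrow> (LINT u|std_normal_distribution. measure lborel B)"
  proof (rule integral_dominated_convergence[where w = "\<lambda>_. measure lborel B"])
    show "AE u in std_normal_distribution. norm (g (u / (2 * pi * real (Suc n)))) \<le> measure lborel B" for n
      using g_le by (auto simp: g_def)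
  qed (use lim in auto)
  then have "(\<lambda>n. LINT u|std_normal_distribution. g (u / (2 * pi * real (Suc n)))) \<longlonglongrightarrow> measure lborel B"
    using G.prob_space by simp
  then have "(\<lambda>n. ennreal (LINT u|std_normal_distribution. g (u / (2 * pi * real (Suc n))))) \<longlonglongrightarrow> ennreal (measure lborel B)"
    by (rule tendsto_ennrealI)
  moreover have "ennreal (LINT u|std_normal_distribution. g (u / (2 * pi * real (Suc n)))) \<le> (\<integral>\<^sup>+t. ennreal (spectral_kernel B t) \<partial>lborel)" for n
  proof -
    have "ennreal (LINT u|std_normal_distribution. g (u / (2 * pi * real (Suc n)))) = (\<integral>\<^sup>+u. ennreal (g (u / (2 * pi * real (Suc n)))) \<partial>std_normal_distribution)"
      by (intro nn_integral_eq_integral[symmetric] int) (auto simp: g_def)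
    then show ?thesis using kernel_integral_ge_average_overlap[OF B, of "real (Suc n)"] by (simp add: g_def)
  qed
  ultimately show ?thesis by (intro LIMSEQ_le_const2) auto
qed

section \<open>First and second moments of the counts\<close>

lemma configuration_algebra_simps:
  "space configuration_algebra = configurations"
  "sets configuration_algebra = sigma_sets configurations {{X \<in> configurations. card (X \<inter> A) = m} | A m. A \<in> sets borel \<and> bounded A}"
  unfolding configuration_algebra_def by (rule space_measure_of sets_measure_of; auto)+

lemma finite_configuration_bounded:
  assumes "X \<in> configurations" "bounded A"
  shows "finite (X \<inter> A)"
proof -
  have "finite (X \<inter> closure A)" using assms by (auto simp: configurations_def)
  then show ?thesis by (rule rev_finite_subset) (use closure_subset in auto)
qed

lemma space_point_process: "point_process P \<Longrightarrow> space P = configurations"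
  unfolding point_process_def by (metis configuration_algebra_simps(1) sets_eq_imp_space_eq)

lemma count_measurable:
  assumes P: "point_process P" and A: "A \<in> sets borel" "bounded A"
  shows "(\<lambda>X. card (X \<inter> A)) \<in> P \<rightarrow>\<^sub>M count_space UNIV"
proof -
  have "{X \<in> space P. card (X \<inter> A) = m} \<in> sets P" for m
  proof -
    have "{X \<in> configurations. card (X \<inter> A) = m} \<in> sets configuration_algebra"
      unfolding configuration_algebra_simps using A by (intro sigma_sets.Basic) auto
    then show ?thesis using P space_point_process[OF P] by (simp add: point_process_def)
  qed
  then show ?thesis
    by (subst measurable_count_space_eq2_countable) (auto simp: vimage_def Int_def conj_commute)
qed

text \<open>
  The instances \<open>k = 1\<close> and \<open>k = 2\<close>, with products of indicators as test functions, give the moments of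
  counts; the sums over distinct tuples are evaluated in the two lemmas that follow.
\<close>

lemma correlation_integral:
  assumes "correlation_function P k \<rho>" "\<phi> \<in> borel_measurable (Pi\<^sub>M {..<k} (\<lambda>_. lborel))"
  shows "(\<integral>\<^sup>+ X. (\<integral>\<^sup>+ x. \<phi> x \<partial>count_space (distinct_tuples k X)) \<partial>P) =
        (\<integral>\<^sup>+ x. \<phi> x * ennreal (Re (\<rho> x)) \<partial>Pi\<^sub>M {..<k} (\<lambda>_. lborel))"
  using assms unfolding correlation_function_def by blast

lemma count_space_distinct_1:
  assumes "finite (X \<inter> A)"
  shows "(\<integral>\<^sup>+ x. indicator A (x 0) \<partial>count_space (distinct_tuples 1 X)) = of_nat (card (X \<inter> A))"
proof -
  let ?T = "{x \<in> distinct_tuples 1 X. x 0 \<in> A}"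
  have bij: "bij_betw (\<lambda>x. x 0) ?T (X \<inter> A)"
  proof (rule bij_betwI[where g = "\<lambda>a i. if i = 0 then a else undefined"])
    show "(\<lambda>x. x 0) \<in> ?T \<rightarrow> X \<inter> A" by (auto simp: distinct_tuples_def)
    show "(\<lambda>a i. if i = 0 then a else undefined) \<in> X \<inter> A \<rightarrow> ?T"
      by (auto simp: distinct_tuples_def inj_on_def split: if_splits)
    show "(\<lambda>i. if i = 0 then x 0 else undefined) = x" if "x \<in> ?T" for x
      using that by (auto simp: distinct_tuples_def PiE_def extensional_def fun_eq_iff)
  qed auto
  have fin: "finite ?T" using bij_betw_finite[OF bij] assms by simp
  have "(\<integral>\<^sup>+ x. indicator A (x 0) \<partial>count_space (distinct_tuples 1 X)) =
      (\<integral>\<^sup>+ x. indicator ?T x \<partial>count_space (distinct_tuples 1 X))"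
    by (intro nn_integral_cong) (auto simp: indicator_def)
  also have "\<dots> = emeasure (count_space (distinct_tuples 1 X)) ?T"
    by (rule nn_integral_indicator) auto
  also have "\<dots> = of_nat (card ?T)" using fin by (subst emeasure_count_space) auto
  also have "card ?T = card (X \<inter> A)" using bij by (rule bij_betw_same_card)
  finally show ?thesis .
qed

text \<open>
  The diagonal pairs, missing from the sum over distinct pairs, are the points of \<open>A \<inter> A'\<close>.
  They are added on the left so as to avoid subtraction of extended numbers.
\<close>

lemma count_space_distinct_2:
  assumes "finite (X \<inter> A)" "finite (X \<inter> A')"
  shows "(\<integral>\<^sup>+ x. indicator A (x 0) * indicator A' (x 1) \<partial>count_space (distinct_tuples 2 X)) + of_nat (card (X \<inter> (A \<inter> A')))
    = of_nat (card (X \<inter> A)) * of_nat (card (X \<inter> A'))"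
proof -
  let ?T = "{x \<in> distinct_tuples 2 X. x 0 \<in> A \<and> x 1 \<in> A'}"
  let ?D = "{(a, b). (a, b) \<in> (X \<inter> A) \<times> (X \<inter> A') \<and> a \<noteq> b}"
  have lt2: "{..<2::nat} = {0, 1}" by auto
  have T_iff: "x \<in> ?T \<longleftrightarrow> x \<in> extensional {0, 1} \<and> x 0 \<in> X \<inter> A \<and> x 1 \<in> X \<inter> A' \<and> x 0 \<noteq> x 1" for x
  proof -
    have "inj_on x {0, 1} \<longleftrightarrow> x 0 \<noteq> x 1" by (simp add: inj_on_def) metis
    moreover have "x \<in> {0, 1} \<rightarrow>\<^sub>E X \<longleftrightarrow> x \<in> extensional {0, 1} \<and> x 0 \<in> X \<and> x 1 \<in> X"
      by (auto simp: PiE_iff)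
    ultimately show ?thesis unfolding distinct_tuples_def lt2 by blast
  qed
  have bij: "bij_betw (\<lambda>x. (x 0, x 1)) ?T ?D"
  proof (rule bij_betwI[where g = "\<lambda>p i. if i = 0 then fst p else if i = 1 then snd p else undefined"])
    show "(\<lambda>x. (x 0, x 1)) \<in> ?T \<rightarrow> ?D"
    proof
      fix x assume "x \<in> ?T"
      then have "x 0 \<in> X \<inter> A" "x 1 \<in> X \<inter> A'" "x 0 \<noteq> x 1" unfolding T_iff by blast+
      then show "(x 0, x 1) \<in> ?D" by simp
    qed
    show "(\<lambda>p i. if i = 0 then fst p else if i = 1 then snd p else undefined) \<in> ?D \<rightarrow> ?T"
      unfolding Pi_iff T_iff by (auto simp: extensional_def)
    show "(\<lambda>i. if i = 0 then fst (x 0, x 1) else if i = 1 then snd (x 0, x 1) else undefined) = x" if "x \<in> ?T" for x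
    proof
      fix i
      have "x \<in> extensional {0, 1}" using that unfolding T_iff by blast
      then show "(if i = 0 then fst (x 0, x 1) else if i = 1 then snd (x 0, x 1) else undefined) = x i"
        by (simp add: extensional_def)
    qed
  qed auto
  have finD: "finite ?D"
    by (rule finite_subset[of _ "(X \<inter> A) \<times> (X \<inter> A')"]) (use assms in auto)
  have fin: "finite ?T" using bij_betw_finite[OF bij] finD by simp
  have "(\<integral>\<^sup>+ x. indicator A (x 0) * indicator A' (x 1) \<partial>count_space (distinct_tuples 2 X)) =
      (\<integral>\<^sup>+ x. indicator ?T x \<partial>count_space (distinct_tuples 2 X))"
    by (intro nn_integral_cong) (auto simp: indicator_def)
  also have "\<dots> = emeasure (count_space (distinct_tuples 2 X)) ?T"
    by (rule nn_integral_indicator) auto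
  also have "\<dots> = of_nat (card ?T)" using fin by (subst emeasure_count_space) auto
  also have "card ?T = card ?D" using bij by (rule bij_betw_same_card)
  finally have *: "(\<integral>\<^sup>+ x. indicator A (x 0) * indicator A' (x 1) \<partial>count_space (distinct_tuples 2 X)) = of_nat (card ?D)" .
  have "card ?D + card ((\<lambda>a. (a, a)) ` (X \<inter> (A \<inter> A'))) = card (?D \<union> (\<lambda>a. (a, a)) ` (X \<inter> (A \<inter> A')))"
    using assms finD by (intro card_Un_disjoint[symmetric]) (auto simp: Int_assoc[symmetric])
  also have "?D \<union> (\<lambda>a. (a, a)) ` (X \<inter> (A \<inter> A')) = (X \<inter> A) \<times> (X \<inter> A')" by auto
  finally have "card ?D + card (X \<inter> (A \<inter> A')) = card (X \<inter> A) * card (X \<inter> A')"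
    by (simp add: card_image inj_on_def card_cartesian_product)
  then have "(of_nat (card ?D + card (X \<inter> (A \<inter> A'))) :: ennreal) = of_nat (card (X \<inter> A) * card (X \<inter> A'))" by (rule arg_cong)
  then show ?thesis unfolding * by simp
qed

lemma det_mat_2:
  fixes f :: "nat \<Rightarrow> nat \<Rightarrow> 'a :: comm_ring_1"
  shows "Determinant.det (Matrix.mat 2 2 (\<lambda>(i, j). f i j)) = f 0 0 * f 1 1 - f 0 1 * f 1 0"
proof -
  let ?A = "Matrix.mat 2 2 (\<lambda>(i, j). f i j)"
  have A: "?A \<in> carrier_mat 2 2" by simp
  have "Determinant.det ?A = (\<Sum>j<2. ?A $$ (0, j) * cofactor ?A 0 j)"
    by (rule laplace_expansion_row[OF A]) simp
  also have "\<dots> = f 0 0 * cofactor ?A 0 0 + f 0 1 * cofactor ?A 0 1"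
    by (simp add: numeral_2_eq_2)
  also have "cofactor ?A 0 0 = f 1 1"
    unfolding cofactor_def by (subst det_single) (auto simp: mat_delete_def)
  also have "cofactor ?A 0 1 = - f 1 0"
    unfolding cofactor_def by (subst det_single) (auto simp: mat_delete_def)
  finally show ?thesis by simp
qed

locale indicator_determinantal =
  fixes B :: "real set" and P :: "real set measure"
  assumes B: "B \<in> sets borel" "bounded B"
    and det: "determinantal_process (\<lambda>x y. fourier_transform (indicator B) (x - y)) P"
begin

lemma process: "point_process P" using det by (simp add: determinantal_process_def)

sublocale prob_space P using process by (simp add: point_process_def)

abbreviation "k \<equiv> spectral_kernel B"
abbreviation "b \<equiv> measure lborel B"

lemma kernel_measurable [measurable]: "(\<lambda>t. k t) \<in> borel_measurable borel"
proof -
  note [measurable] = B(1)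
  have [measurable]: "fourier_transform (indicator B :: real \<Rightarrow> complex) \<in> borel_measurable borel" by measurable
  show ?thesis by measurable
qed

lemma kernel_le: "k t \<le> b\<^sup>2"
  using fourier_indicator_bound[OF B] by (intro power_mono) auto

lemma expected_count:
  assumes A: "A \<in> sets borel" "bounded A"
  shows "(\<integral>\<^sup>+X. of_nat (card (X \<inter> A)) \<partial>P) = ennreal b * emeasure lborel A"
proof -
  note [measurable] = A(1)
  interpret prod: product_sigma_finite "\<lambda>_::nat. lborel :: real measure" ..
  have one: "{..<1::nat} = {0}" by auto
  have "(\<integral>\<^sup>+X. of_nat (card (X \<inter> A)) \<partial>P) =
      (\<integral>\<^sup>+X. (\<integral>\<^sup>+ x. indicator A (x 0) \<partial>count_space (distinct_tuples 1 X)) \<partial>P)"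
    by (intro nn_integral_cong count_space_distinct_1[symmetric] finite_configuration_bounded)
       (use A space_point_process[OF process] in auto)
  also have "\<dots> = (\<integral>\<^sup>+ x. indicator A (x 0) * ennreal (Re (Determinant.det (Matrix.mat 1 1 (\<lambda>(i, j). fourier_transform (indicator B) (x i - x j))))) \<partial>Pi\<^sub>M {..<1} (\<lambda>_. lborel))"
    by (rule correlation_integral) (use det in \<open>auto simp: determinantal_process_def one\<close>)
  also have "\<dots> = (\<integral>\<^sup>+ x. indicator A (x 0) * ennreal b \<partial>Pi\<^sub>M {0::nat} (\<lambda>_. lborel))"
    unfolding one by (simp add: det_single fourier_indicator_0[OF B])
  also have "\<dots> = (\<integral>\<^sup>+ x. indicator A x * ennreal b \<partial>lborel)"
    by (rule prod.product_nn_integral_singleton[of "\<lambda>x. indicator A x * ennreal b"]) simp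
  also have "\<dots> = ennreal b * emeasure lborel A"
    by (subst nn_integral_multc) (auto simp: mult.commute)
  finally show ?thesis .
qed

text \<open>
  The two-point correlation function is \<open>b\<^sup>2 - k(x - y)\<close>, the kernel being Hermitian. The subtracted part
  is kept on the left-hand side, where everything is a nonnegative extended number.
\<close>

lemma expected_product:
  assumes A: "A \<in> sets borel" "bounded A" and A': "A' \<in> sets borel" "bounded A'"
  shows "(\<integral>\<^sup>+X. of_nat (card (X \<inter> A)) * of_nat (card (X \<inter> A')) \<partial>P)
      + (\<integral>\<^sup>+x. indicator A x * (\<integral>\<^sup>+y. indicator A' y * ennreal (k (x - y)) \<partial>lborel) \<partial>lborel)
    = ennreal (b\<^sup>2) * emeasure lborel A * emeasure lborel A' + ennreal b * emeasure lborel (A \<inter> A')"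
proof -
  note [measurable] = A(1) A'(1)
  interpret prod: product_sigma_finite "\<lambda>_::nat. lborel :: real measure" ..
  have two: "{..<2::nat} = {0, 1}" by auto
  let ?K = "\<lambda>x y. fourier_transform (indicator B) (x - y :: real)"
  have detK: "Re (Determinant.det (Matrix.mat 2 2 (\<lambda>(i, j). ?K (x i) (x j)))) = b\<^sup>2 - k (x 0 - x 1)" for x :: "nat \<Rightarrow> real"
  proof -
    have "Determinant.det (Matrix.mat 2 2 (\<lambda>(i, j). ?K (x i) (x j))) = ?K (x 0) (x 0) * ?K (x 1) (x 1) - ?K (x 0) (x 1) * ?K (x 1) (x 0)"
      by (rule det_mat_2)
    also have "?K (x 1) (x 0) = cnj (?K (x 0) (x 1))"
      using fourier_indicator_minus[OF B, of "x 0 - x 1"] by simp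
    finally show ?thesis
      by (simp add: fourier_indicator_0[OF B] complex_norm_square[symmetric] power2_eq_square del: of_real_power of_real_mult)
  qed
  let ?S = "\<lambda>X. \<integral>\<^sup>+ x. indicator A (x 0) * indicator A' (x 1) \<partial>count_space (distinct_tuples 2 X)"
  have S: "(\<integral>\<^sup>+X. ?S X \<partial>P) = (\<integral>\<^sup>+x. indicator A x * (\<integral>\<^sup>+y. indicator A' y * ennreal (b\<^sup>2 - k (x - y)) \<partial>lborel) \<partial>lborel)"
  proof -
    have "(\<integral>\<^sup>+X. ?S X \<partial>P) = (\<integral>\<^sup>+ x. (indicator A (x 0) * indicator A' (x 1)) * ennreal (Re (Determinant.det (Matrix.mat 2 2 (\<lambda>(i, j). ?K (x i) (x j))))) \<partial>Pi\<^sub>M {..<2} (\<lambda>_. lborel))"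
      by (rule correlation_integral) (use det in \<open>auto simp: determinantal_process_def two\<close>)
    also have "\<dots> = (\<integral>\<^sup>+ x. (\<lambda>s t. (indicator A s * indicator A' t) * ennreal (b\<^sup>2 - k (s - t))) (x 0) (x 1) \<partial>Pi\<^sub>M {0::nat, 1} (\<lambda>_. lborel))"
      unfolding detK two ..
    also have "\<dots> = (\<integral>\<^sup>+z. (indicator A (fst z) * indicator A' (snd z)) * ennreal (b\<^sup>2 - k (fst z - snd z)) \<partial>(lborel \<Otimes>\<^sub>M lborel))"
      by (rule prod.product_nn_integral_pair) (auto simp: split_beta)
    also have "\<dots> = (\<integral>\<^sup>+x. \<integral>\<^sup>+y. (indicator A x * indicator A' y) * ennreal (b\<^sup>2 - k (x - y)) \<partial>lborel \<partial>lborel)"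
      by (subst lborel.nn_integral_fst[symmetric]) auto
    also have "\<dots> = (\<integral>\<^sup>+x. indicator A x * (\<integral>\<^sup>+y. indicator A' y * ennreal (b\<^sup>2 - k (x - y)) \<partial>lborel) \<partial>lborel)"
      unfolding mult.assoc by (intro nn_integral_cong nn_integral_cmult) measurable
    finally show ?thesis .
  qed
  have N [measurable]: "(\<lambda>X. of_nat (card (X \<inter> C)) :: ennreal) \<in> borel_measurable P" if "C \<in> sets borel" "bounded C" for C
    by (rule measurable_compose[OF count_measurable[OF process that]]) simp
  have prodN: "(\<integral>\<^sup>+X. of_nat (card (X \<inter> A)) * of_nat (card (X \<inter> A')) \<partial>P) = (\<integral>\<^sup>+X. ?S X \<partial>P) + (\<integral>\<^sup>+X. of_nat (card (X \<inter> (A \<inter> A'))) \<partial>P)"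
  proof -
    have fin: "finite (X \<inter> A)" "finite (X \<inter> A')" "finite (X \<inter> (A \<inter> A'))" if "X \<in> space P" for X
      using that A A' space_point_process[OF process] by (auto intro!: finite_configuration_bounded)
    have AA: "A \<inter> A' \<in> sets borel" "bounded (A \<inter> A')"
      using A A' by (auto intro: bounded_subset)
    let ?d = "\<lambda>X. of_nat (card (X \<inter> A)) * of_nat (card (X \<inter> A')) - of_nat (card (X \<inter> (A \<inter> A'))) :: ennreal"
    have "(\<integral>\<^sup>+X. of_nat (card (X \<inter> A)) * of_nat (card (X \<inter> A')) \<partial>P) = (\<integral>\<^sup>+X. ?S X + of_nat (card (X \<inter> (A \<inter> A'))) \<partial>P)"
      by (rule nn_integral_cong) (rule count_space_distinct_2[symmetric, OF fin(1,2)])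
    also have "\<dots> = (\<integral>\<^sup>+X. ?S X \<partial>P) + (\<integral>\<^sup>+X. of_nat (card (X \<inter> (A \<inter> A'))) \<partial>P)"
    proof (rule nn_integral_add)
      have "?S X = ?d X" if "X \<in> space P" for X
        unfolding count_space_distinct_2[OF fin(1,2)[OF that], symmetric]
        by (rule ennreal_add_diff_cancel_right[symmetric]) (rule ennreal_of_nat_neq_top)
      moreover have "?d \<in> borel_measurable P"
        by (intro borel_measurable_minus_ennreal borel_measurable_times_ennreal N A A' AA)
      ultimately show "?S \<in> borel_measurable P"
        using measurable_cong[of P ?S ?d borel] by blast
    qed (rule N[OF AA])
    finally show ?thesis .
  qed
  have "(\<integral>\<^sup>+x. indicator A x * (\<integral>\<^sup>+y. indicator A' y * ennreal (b\<^sup>2 - k (x - y)) \<partial>lborel) \<partial>lborel)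
      + (\<integral>\<^sup>+x. indicator A x * (\<integral>\<^sup>+y. indicator A' y * ennreal (k (x - y)) \<partial>lborel) \<partial>lborel)
      = (\<integral>\<^sup>+x. indicator A x * ((\<integral>\<^sup>+y. indicator A' y * ennreal (b\<^sup>2 - k (x - y)) \<partial>lborel) + (\<integral>\<^sup>+y. indicator A' y * ennreal (k (x - y)) \<partial>lborel)) \<partial>lborel)"
    unfolding distrib_left by (rule nn_integral_add[symmetric]) measurable
  also have "\<dots> = (\<integral>\<^sup>+x. indicator A x * (ennreal (b\<^sup>2) * emeasure lborel A') \<partial>lborel)"
  proof (intro nn_integral_cong arg_cong2[where f = "(*)"] refl)
    fix x :: real
    have "(\<integral>\<^sup>+y. indicator A' y * ennreal (b\<^sup>2 - k (x - y)) \<partial>lborel) + (\<integral>\<^sup>+y. indicator A' y * ennreal (k (x - y)) \<partial>lborel)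
        = (\<integral>\<^sup>+y. indicator A' y * ennreal (b\<^sup>2 - k (x - y)) + indicator A' y * ennreal (k (x - y)) \<partial>lborel)"
      by (rule nn_integral_add[symmetric]) measurable
    also have "\<dots> = (\<integral>\<^sup>+y. ennreal (b\<^sup>2) * indicator A' y \<partial>lborel)"
    proof (rule nn_integral_cong)
      fix y
      have "ennreal (b\<^sup>2 - k (x - y)) + ennreal (k (x - y)) = ennreal (b\<^sup>2)"
        using kernel_le[of "x - y"] by (subst ennreal_plus[symmetric]) auto
      then show "indicator A' y * ennreal (b\<^sup>2 - k (x - y)) + indicator A' y * ennreal (k (x - y)) = ennreal (b\<^sup>2) * indicator A' y"
        unfolding distrib_left[symmetric] by (simp add: mult.commute)
    qed
    also have "\<dots> = ennreal (b\<^sup>2) * emeasure lborel A'" by (subst nn_integral_cmult) auto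
    finally show "(\<integral>\<^sup>+y. indicator A' y * ennreal (b\<^sup>2 - k (x - y)) \<partial>lborel) + (\<integral>\<^sup>+y. indicator A' y * ennreal (k (x - y)) \<partial>lborel) = ennreal (b\<^sup>2) * emeasure lborel A'" .
  qed
  also have "\<dots> = ennreal (b\<^sup>2) * emeasure lborel A * emeasure lborel A'"
    by (subst nn_integral_multc) (auto simp: ac_simps)
  finally have "(\<integral>\<^sup>+x. indicator A x * (\<integral>\<^sup>+y. indicator A' y * ennreal (b\<^sup>2 - k (x - y)) \<partial>lborel) \<partial>lborel)
      + (\<integral>\<^sup>+x. indicator A x * (\<integral>\<^sup>+y. indicator A' y * ennreal (k (x - y)) \<partial>lborel) \<partial>lborel)
      = ennreal (b\<^sup>2) * emeasure lborel A * emeasure lborel A'" .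
  note split = this
  have diag: "(\<integral>\<^sup>+X. of_nat (card (X \<inter> (A \<inter> A'))) \<partial>P) = ennreal b * emeasure lborel (A \<inter> A')"
    by (rule expected_count) (use A in auto)
  show ?thesis unfolding prodN S diag split[symmetric] by (simp only: add_ac)
qed

end

section \<open>Interaction between boxes\<close>

lemma integer_lattice_real: "(integer_lattice :: real set) = range of_int"
  by (auto simp: integer_lattice_def Ints_def)

lemma box_at_real: "box_at l (x :: real) = {l * x - l / 2..<l * x + l / 2}"
  by (auto simp: box_at_def)

text \<open>
  A linear combination in the closed span is given by coefficients attached to functions, not to indices.
  Injectivity allows one to pass between them.
\<close>

lemma box_count_inj:
  assumes "l > 0"
  shows "inj (\<lambda>n :: int. box_count l (real_of_int n))"
proof (rule injI)
  fix n m :: int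
  assume eq: "box_count l (real_of_int n) = box_count l (real_of_int m)"
  let ?X = "{l * real_of_int n}"
  have "?X \<inter> box_at l (real_of_int n) = ?X" using assms by (auto simp: box_at_real)
  then have "box_count l (real_of_int m) ?X = 1" by (simp add: eq[symmetric] box_count_def)
  then have "card (?X \<inter> box_at l (real_of_int m)) \<noteq> 0" by (simp add: box_count_def)
  then have "?X \<inter> box_at l (real_of_int m) \<noteq> {}" by (metis card.empty)
  then have "l * m - l / 2 \<le> l * n" "l * n < l * m + l / 2" by (auto simp: box_at_real)
  then have "l * (real_of_int m - n) \<le> l * (1 / 2)" "l * (real_of_int n - m) < l * (1 / 2)"
    by (auto simp: algebra_simps)
  then have "real_of_int m - n \<le> 1 / 2" "real_of_int n - m < 1 / 2"
    using assms by (auto simp only: mult_le_cancel_left_pos mult_less_cancel_left_pos)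
  then show "n = m" by linarith
qed

text \<open>
  The decay hypothesis in the form in which it is applied, with a named finite constant.
\<close>

locale decaying_determinantal = indicator_determinantal +
  fixes C\<^sub>0 :: real
  assumes C0: "0 \<le> C\<^sub>0"
    and decay: "\<And>R. R > 0 \<Longrightarrow> (\<integral>\<^sup>+t. indicator {t. \<bar>t\<bar> \<ge> R} t * ennreal (k t) \<partial>lborel) \<le> ennreal (C\<^sub>0 / R)"
begin

lemma kernel_integral_finite: "(\<integral>\<^sup>+t. ennreal (k t) \<partial>lborel) < \<infinity>"
proof -
  have "(\<integral>\<^sup>+t. ennreal (k t) \<partial>lborel) \<le>
      (\<integral>\<^sup>+t. ennreal (b\<^sup>2) * indicator {-1..1} t + indicator {t. \<bar>t\<bar> \<ge> 1} t * ennreal (k t) \<partial>lborel)"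
    using kernel_le by (intro nn_integral_mono) (auto simp: indicator_def intro: ennreal_leI)
  also have "\<dots> = ennreal (b\<^sup>2) * emeasure lborel {-1..1::real} + (\<integral>\<^sup>+t. indicator {t. \<bar>t\<bar> \<ge> 1} t * ennreal (k t) \<partial>lborel)"
    by (subst nn_integral_add) (auto simp: nn_integral_cmult)
  also have "\<dots> < \<infinity>"
    using decay[of 1] by (auto simp: ennreal_mult_less_top intro: le_less_trans)
  finally show ?thesis .
qed

definition smeared_kernel :: "real set \<Rightarrow> real \<Rightarrow> ennreal" where
  "smeared_kernel A y = (\<integral>\<^sup>+x. indicator A x * ennreal (k (x - y)) \<partial>lborel)"

lemma smeared_kernel_measurable [measurable]:
  assumes [measurable]: "A \<in> sets borel"
  shows "smeared_kernel A \<in> borel_measurable borel"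
  unfolding smeared_kernel_def by measurable

text \<open>
  The measure \<open>A \<mapsto> \<integral>\<^sub>x \<integral>\<^sub>y k(x - y)\<close> with \<open>x\<close> in the central box and \<open>y\<close> in \<open>A\<close>. Encoding the double
  integrals as a measure in the second variable makes partial sums of the \<open>\<kappa>\<^sub>j\<close> into measures
  of unions of boxes.
\<close>

definition interaction :: "real \<Rightarrow> real measure" where
  "interaction l = density lborel (smeared_kernel (box_at l (0::real)))"

lemma box_sets [measurable]: "box_at l (x :: real) \<in> sets borel"
  by (simp add: box_at_real)

lemma sets_interaction [measurable_cong]: "sets (interaction l) = sets borel"
  by (simp add: interaction_def)

lemma emeasure_interaction:
  assumes [measurable]: "A \<in> sets borel"
  shows "emeasure (interaction l) A =
    (\<integral>\<^sup>+x. indicator (box_at l (0::real)) x * (\<integral>\<^sup>+y. indicator A y * ennreal (k (x - y)) \<partial>lborel) \<partial>lborel)"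
proof -
  have "emeasure (interaction l) A = (\<integral>\<^sup>+y. (\<integral>\<^sup>+x. indicator (box_at l (0::real)) x * ennreal (k (x - y)) \<partial>lborel) * indicator A y \<partial>lborel)"
    unfolding interaction_def by (subst emeasure_density) (auto simp: smeared_kernel_def)
  also have "\<dots> = (\<integral>\<^sup>+y. \<integral>\<^sup>+x. (indicator (box_at l (0::real)) x * ennreal (k (x - y))) * indicator A y \<partial>lborel \<partial>lborel)"
    by (intro nn_integral_cong nn_integral_multc[symmetric]) measurable
  also have "\<dots> = (\<integral>\<^sup>+x. \<integral>\<^sup>+y. (indicator (box_at l (0::real)) x * ennreal (k (x - y))) * indicator A y \<partial>lborel \<partial>lborel)"
    by (rule lborel_pair.Fubini') measurable
  also have "\<dots> = (\<integral>\<^sup>+x. indicator (box_at l (0::real)) x * (\<integral>\<^sup>+y. indicator A y * ennreal (k (x - y)) \<partial>lborel) \<partial>lborel)"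
  proof (rule nn_integral_cong)
    fix x :: real
    have "(\<integral>\<^sup>+y. (indicator (box_at l (0::real)) x * ennreal (k (x - y))) * indicator A y \<partial>lborel) =
        (\<integral>\<^sup>+y. indicator (box_at l (0::real)) x * (indicator A y * ennreal (k (x - y))) \<partial>lborel)"
      by (simp only: ac_simps)
    also have "\<dots> = indicator (box_at l (0::real)) x * (\<integral>\<^sup>+y. indicator A y * ennreal (k (x - y)) \<partial>lborel)"
      by (rule nn_integral_cmult) measurable
    finally show "(\<integral>\<^sup>+y. (indicator (box_at l (0::real)) x * ennreal (k (x - y))) * indicator A y \<partial>lborel) =
      indicator (box_at l (0::real)) x * (\<integral>\<^sup>+y. indicator A y * ennreal (k (x - y)) \<partial>lborel)" .
  qed
  finally show ?thesis .
qed

lemma emeasure_box: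
  assumes "l > 0" shows "emeasure lborel (box_at l (x :: real)) = ennreal l"
  using assms by (simp add: box_at_real)

lemma kernel_integral_reflect:
  fixes f :: "real \<Rightarrow> ennreal"
  assumes [measurable]: "f \<in> borel_measurable borel"
  shows "(\<integral>\<^sup>+y. f (x - y) \<partial>lborel) = (\<integral>\<^sup>+t. f t \<partial>lborel)"
  by (subst (2) nn_integral_real_affine[where t = x and c = "-1"]) auto

lemma emeasure_interaction_le:
  assumes [measurable]: "A \<in> sets borel" and l: "l > 0"
    and bound: "\<And>x. x \<in> box_at l (0::real) \<Longrightarrow> (\<integral>\<^sup>+y. indicator A y * ennreal (k (x - y)) \<partial>lborel) \<le> c"
  shows "emeasure (interaction l) A \<le> c * ennreal l"
proof -
  have "emeasure (interaction l) A \<le> (\<integral>\<^sup>+x. c * indicator (box_at l (0::real)) x \<partial>lborel)"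
    unfolding emeasure_interaction[OF assms(1)]
  proof (rule nn_integral_mono)
    fix x :: real
    show "indicator (box_at l (0::real)) x * (\<integral>\<^sup>+y. indicator A y * ennreal (k (x - y)) \<partial>lborel) \<le> c * indicator (box_at l (0::real)) x"
      using bound[of x] by (cases "x \<in> box_at l (0::real)") auto
  qed
  also have "\<dots> = c * ennreal l" using emeasure_box[OF l] by (subst nn_integral_cmult) auto
  finally show ?thesis .
qed

lemma emeasure_interaction_UNIV:
  assumes l: "l > 0"
  shows "emeasure (interaction l) UNIV = (\<integral>\<^sup>+t. ennreal (k t) \<partial>lborel) * ennreal l"
proof -
  have "emeasure (interaction l) UNIV = (\<integral>\<^sup>+x. indicator (box_at l (0::real)) x * (\<integral>\<^sup>+y. ennreal (k (x - y)) \<partial>lborel) \<partial>lborel)"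
    by (subst emeasure_interaction) auto
  also have "\<dots> = (\<integral>\<^sup>+x. indicator (box_at l (0::real)) x * (\<integral>\<^sup>+t. ennreal (k t) \<partial>lborel) \<partial>lborel)"
  proof -
    have "(\<integral>\<^sup>+y. ennreal (k (x - y)) \<partial>lborel) = (\<integral>\<^sup>+t. ennreal (k t) \<partial>lborel)" for x
      by (rule kernel_integral_reflect[of "\<lambda>t. ennreal (k t)"]) measurable
    then show ?thesis by (simp only:)
  qed
  also have "\<dots> = (\<integral>\<^sup>+t. ennreal (k t) \<partial>lborel) * ennreal l"
    using emeasure_box[OF l] by (subst nn_integral_multc) (auto simp: mult.commute)
  finally show ?thesis .
qed

lemma finite_interaction:
  assumes "l > 0" shows "finite_measure (interaction l)"
proof (rule finite_measureI)
  have "space (interaction l) = UNIV" by (simp add: interaction_def)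
  then show "emeasure (interaction l) (space (interaction l)) \<noteq> \<infinity>"
    using kernel_integral_finite emeasure_interaction_UNIV[OF assms] by (simp add: ennreal_mult_eq_top_iff)
qed

lemma interaction_translate:
  assumes l: "l > 0"
  shows "(\<integral>\<^sup>+x. indicator (box_at l (real_of_int n)) x * (\<integral>\<^sup>+y. indicator (box_at l (real_of_int m)) y * ennreal (k (x - y)) \<partial>lborel) \<partial>lborel)
    = emeasure (interaction l) (box_at l (real_of_int (m - n)))"
proof -
  have shift: "indicator (box_at l (real_of_int j)) (l * real_of_int n + y) = (indicator (box_at l (real_of_int (j - n))) y :: ennreal)" for j :: int and y
    by (auto simp: indicator_def box_at_real algebra_simps)
  have inner: "(\<integral>\<^sup>+y. indicator (box_at l (real_of_int m)) y * ennreal (k ((l * real_of_int n + x) - y)) \<partial>lborel)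
      = (\<integral>\<^sup>+y. indicator (box_at l (real_of_int (m - n))) y * ennreal (k (x - y)) \<partial>lborel)" for x
    by (subst nn_integral_real_affine[where t = "l * real_of_int n" and c = 1]) (auto simp: shift)
  have "(\<integral>\<^sup>+x. indicator (box_at l (real_of_int n)) x * (\<integral>\<^sup>+y. indicator (box_at l (real_of_int m)) y * ennreal (k (x - y)) \<partial>lborel) \<partial>lborel)
      = (\<integral>\<^sup>+x. indicator (box_at l (real_of_int n)) (l * real_of_int n + 1 * x) * (\<integral>\<^sup>+y. indicator (box_at l (real_of_int m)) y * ennreal (k ((l * real_of_int n + 1 * x) - y)) \<partial>lborel) \<partial>lborel)"
    by (subst nn_integral_real_affine[where t = "l * real_of_int n" and c = 1]) auto
  also have "\<dots> = emeasure (interaction l) (box_at l (real_of_int (m - n)))"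
    unfolding mult_1 shift inner by (subst emeasure_interaction) auto
  finally show ?thesis .
qed

text \<open>
  The numbers \<open>\<kappa>\<^sub>j\<close> of the introductory comment.
\<close>

definition coupling :: "real \<Rightarrow> int \<Rightarrow> real" where
  "coupling l j = measure (interaction l) (box_at l (real_of_int j))"

lemma disjoint_boxes:
  assumes "l > 0" "n \<noteq> m"
  shows "box_at l (real_of_int n) \<inter> box_at l (real_of_int m) = {}"
proof (rule ccontr)
  assume "\<not> ?thesis"
  then obtain x where "x \<in> box_at l (real_of_int n)" "x \<in> box_at l (real_of_int m)" by blast
  then have "l * real_of_int n - l / 2 < l * real_of_int m + l / 2" "l * real_of_int m - l / 2 < l * real_of_int n + l / 2"
    by (auto simp: box_at_real)
  then have "l * (real_of_int n - m) < l * 1" "l * (real_of_int m - n) < l * 1"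
    by (auto simp: algebra_simps)
  then have "real_of_int n - m < 1" "real_of_int m - n < 1"
    using assms(1) by (auto simp only: mult_less_cancel_left_pos)
  then show False using assms(2) by linarith
qed

lemma sum_coupling:
  assumes l: "l > 0" and "finite I"
  shows "(\<Sum>j\<in>I. coupling l j) = measure (interaction l) (\<Union>j\<in>I. box_at l (real_of_int j))"
proof -
  interpret finite_measure "interaction l" by (rule finite_interaction[OF l])
  show ?thesis unfolding coupling_def
    by (rule finite_measure_finite_Union[symmetric])
       (use assms disjoint_boxes[OF l] in \<open>auto simp: disjoint_family_on_def sets_interaction\<close>)
qed

text \<open>
  The constant \<open>2 C\<^sub>0\<close> serves for \<open>m \<ge> 2\<close>. The decay hypothesis says nothing about \<open>\<bar>x - y\<bar>\<close> near
  \<open>0\<close>, which occurs for \<open>m = 1\<close>, and there the total mass is taken.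
\<close>

definition tail_constant :: "real \<Rightarrow> real" where
  "tail_constant l = max (2 * C\<^sub>0) (measure (interaction l) UNIV)"

text \<open>
  A point with \<open>\<bar>y\<bar> \<ge> l (m - 1/2)\<close> has distance at least \<open>l (m - 1)\<close> from the central box, and
  \<open>1 / (m - 1) \<le> 2 / m\<close> if \<open>m \<ge> 2\<close>.
\<close>

lemma interaction_tail:
  assumes l: "l > 0" and m: "m \<ge> (1::nat)"
  shows "measure (interaction l) {y. \<bar>y\<bar> \<ge> l * (real m - 1 / 2)} \<le> tail_constant l / real m"
proof (cases "m = 1")
  case True
  interpret finite_measure "interaction l" by (rule finite_interaction[OF l])
  have "measure (interaction l) {y. \<bar>y\<bar> \<ge> l * (real m - 1 / 2)} \<le> measure (interaction l) UNIV"
    by (intro finite_measure_mono) (auto simp: sets_interaction)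
  then show ?thesis using True by (simp add: tail_constant_def)
next
  case False
  then have m2: "real m \<ge> 2" using m by simp
  let ?A = "{y. \<bar>y\<bar> \<ge> l * (real m - 1 / 2)}"
  define R where "R = l * (real m - 1)"
  have R: "R > 0" using l m2 by (simp add: R_def)
  have "(\<integral>\<^sup>+y. indicator ?A y * ennreal (k (x - y)) \<partial>lborel) \<le> ennreal (C\<^sub>0 / R)" if x: "x \<in> box_at l (0::real)" for x
  proof -
    have "(\<integral>\<^sup>+y. indicator ?A y * ennreal (k (x - y)) \<partial>lborel) \<le>
        (\<integral>\<^sup>+y. indicator {t. \<bar>t\<bar> \<ge> R} (x - y) * ennreal (k (x - y)) \<partial>lborel)"
    proof (intro nn_integral_mono mult_right_mono)
      fix y :: real
      have "\<bar>x\<bar> \<le> l / 2" using x by (auto simp: box_at_real)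
      then have "\<bar>x - y\<bar> \<ge> R" if "y \<in> ?A" using that by (auto simp: R_def algebra_simps abs_if split: if_splits)
      then show "indicator ?A y \<le> (indicator {t. \<bar>t\<bar> \<ge> R} (x - y) :: ennreal)" by (auto simp: indicator_def)
    qed auto
    also have "\<dots> = (\<integral>\<^sup>+t. indicator {t. \<bar>t\<bar> \<ge> R} t * ennreal (k t) \<partial>lborel)"
      by (rule kernel_integral_reflect) measurable
    also have "\<dots> \<le> ennreal (C\<^sub>0 / R)" using decay[OF R] .
    finally show ?thesis .
  qed
  then have "emeasure (interaction l) ?A \<le> ennreal (C\<^sub>0 / R) * ennreal l"
    by (intro emeasure_interaction_le l) auto
  also have "\<dots> = ennreal (C\<^sub>0 / (real m - 1))"
    using l by (subst ennreal_mult''[symmetric]) (auto simp: R_def)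
  finally have "measure (interaction l) ?A \<le> C\<^sub>0 / (real m - 1)"
    unfolding measure_def using C0 m2 by (intro enn2real_leI) auto
  also have "\<dots> \<le> 2 * C\<^sub>0 / real m"
  proof -
    have "C\<^sub>0 * real m \<le> C\<^sub>0 * (2 * (real m - 1))" using C0 m2 by (intro mult_left_mono) auto
    then show ?thesis using m2 by (simp add: field_simps)
  qed
  also have "\<dots> \<le> tail_constant l / real m" by (intro divide_right_mono) (auto simp: tail_constant_def)
  finally show ?thesis .
qed

lemma coupling_tail:
  assumes l: "l > 0" and m: "m \<ge> (1::nat)"
  shows "(\<Sum>j\<in>{j \<in> {-int J..int J}. int m \<le> \<bar>j\<bar>}. coupling l j) \<le> tail_constant l / real m"
proof -
  interpret finite_measure "interaction l" by (rule finite_interaction[OF l])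
  let ?I = "{j \<in> {-int J..int J}. int m \<le> \<bar>j\<bar>}"
  have sub: "box_at l (real_of_int j) \<subseteq> {y. \<bar>y\<bar> \<ge> l * (real m - 1 / 2)}" if "int m \<le> \<bar>j\<bar>" for j
  proof
    fix y assume "y \<in> box_at l (real_of_int j)"
    then have y: "\<bar>y - l * real_of_int j\<bar> \<le> l / 2"
      by (simp only: box_at_real atLeastLessThan_iff abs_le_iff) linarith
    have "l * real m \<le> l * \<bar>real_of_int j\<bar>" using that l by (intro mult_left_mono) linarith+
    also have "\<dots> = \<bar>l * real_of_int j\<bar>" using l by (simp add: abs_mult)
    finally have "l * real m - l / 2 \<le> \<bar>y\<bar>" using y by linarith
    then show "y \<in> {y. \<bar>y\<bar> \<ge> l * (real m - 1 / 2)}" by (simp add: algebra_simps)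
  qed
  have "(\<Sum>j\<in>?I. coupling l j) = measure (interaction l) (\<Union>j\<in>?I. box_at l (real_of_int j))"
    by (rule sum_coupling[OF l]) (rule finite_subset[of _ "{-int J..int J}"], auto)
  also have "\<dots> \<le> measure (interaction l) {y. \<bar>y\<bar> \<ge> l * (real m - 1 / 2)}"
    using sub by (intro finite_measure_mono) (auto simp: sets_interaction)
  also have "\<dots> \<le> tail_constant l / real m" by (rule interaction_tail[OF l m])
  finally show ?thesis .
qed

text \<open>
  By Plancherel and translation invariance the whole mass of the interaction measure is at least
  \<open>b l\<close>; the boxes with \<open>\<bar>j\<bar> \<le> J\<close> miss only the tail from \<open>J + 1\<close> on.
\<close>

lemma coupling_total:
  assumes l: "l > 0" and J: "J \<ge> (1::nat)"
  shows "b * l \<le> (\<Sum>j\<in>{-int J..int J}. coupling l j) + tail_constant l / real J"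
proof -
  interpret finite_measure "interaction l" by (rule finite_interaction[OF l])
  let ?U = "\<Union>j\<in>{-int J..int J}. box_at l (real_of_int j)"
  let ?A = "{y. \<bar>y\<bar> \<ge> l * (real (Suc J) - 1 / 2)}"
  have cover: "UNIV \<subseteq> ?U \<union> ?A"
  proof
    fix y :: real
    define j where "j = \<lfloor>y / l + 1 / 2\<rfloor>"
    have j: "real_of_int j \<le> y / l + 1 / 2" "y / l + 1 / 2 < real_of_int j + 1" unfolding j_def by linarith+
    then have box: "y \<in> box_at l (real_of_int j)" using l by (auto simp: box_at_real field_simps)
    show "y \<in> ?U \<union> ?A"
    proof (cases "\<bar>y\<bar> \<ge> l * (real (Suc J) - 1 / 2)")
      case False
      then have "\<bar>y / l\<bar> < real J + 1 / 2" using l by (simp add: abs_divide field_simps)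
      then have "real_of_int j < real J + 1" "- real J - 1 < real_of_int j" using j by linarith+
      then have "j \<in> {-int J..int J}" by auto
      then show ?thesis using box by blast
    qed simp
  qed
  have "ennreal (b * l) = ennreal b * ennreal l" using l by (simp add: ennreal_mult)
  also have "\<dots> \<le> (\<integral>\<^sup>+t. ennreal (k t) \<partial>lborel) * ennreal l"
    using plancherel_lower_bound[OF B] by (rule mult_right_mono) simp
  also have "\<dots> = ennreal (measure (interaction l) UNIV)"
    using emeasure_interaction_UNIV[OF l] by (simp add: emeasure_eq_measure)
  finally have "b * l \<le> measure (interaction l) UNIV" by (simp add: ennreal_le_iff)
  also have "\<dots> \<le> measure (interaction l) (?U \<union> ?A)"
    using cover by (intro finite_measure_mono) (auto simp: sets_interaction)
  also have "\<dots> \<le> measure (interaction l) ?U + measure (interaction l) ?A"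
    by (intro measure_Un_le) (auto simp: sets_interaction)
  also have "measure (interaction l) ?A \<le> tail_constant l / real (Suc J)"
    by (rule interaction_tail[OF l]) simp
  also have "\<dots> \<le> tail_constant l / real J"
  proof (intro divide_left_mono)
    show "0 \<le> tail_constant l" unfolding tail_constant_def using measure_nonneg by (meson max.coboundedI2)
  qed (use J in auto)
  also have "measure (interaction l) ?U = (\<Sum>j\<in>{-int J..int J}. coupling l j)"
    by (rule sum_coupling[OF l, symmetric]) simp
  finally show ?thesis by simp
qed

lemma box_count_measurable [measurable]:
  "box_count l (x :: real) \<in> borel_measurable P"
proof -
  have "bounded (box_at l x)" by (simp add: box_at_real)
  from measurable_compose[OF count_measurable[OF process box_sets this], of real borel]
  show ?thesis unfolding box_count_def by simp
qed

text \<open>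
  The mixed second moments of the counts. The boxes are disjoint unless \<open>n = m\<close>, so pairs of coinciding
  points contribute only on the diagonal.
\<close>

lemma box_count_product:
  assumes l: "l > 0"
  defines "N \<equiv> \<lambda>n. box_count l (real_of_int n)"
  shows "integrable P (\<lambda>X. N n X * N m X)"
    and "(LINT X|P. N n X * N m X) = (b * l)\<^sup>2 - coupling l (m - n) + (if n = m then b * l else 0)"
proof -
  interpret I: finite_measure "interaction l" by (rule finite_interaction[OF l])
  have bd: "bounded (box_at l (real_of_int n))" for n by (simp add: box_at_real)
  have int: "emeasure lborel (box_at l (real_of_int n) \<inter> box_at l (real_of_int m)) = ennreal (if n = m then l else 0)"
    using emeasure_box[OF l] disjoint_boxes[OF l] by simp
  have nn: "(\<integral>\<^sup>+X. ennreal (N n X * N m X) \<partial>P) =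
      (\<integral>\<^sup>+X. of_nat (card (X \<inter> box_at l (real_of_int n))) * of_nat (card (X \<inter> box_at l (real_of_int m))) \<partial>P)"
    by (simp add: N_def box_count_def ennreal_mult ennreal_of_nat_eq_real_of_nat)
  have "(\<integral>\<^sup>+X. ennreal (N n X * N m X) \<partial>P) + ennreal (coupling l (m - n))
      = ennreal (b\<^sup>2) * ennreal l * ennreal l + ennreal b * ennreal (if n = m then l else 0)"
    using expected_product[OF box_sets[of l "real_of_int n"] bd[of n] box_sets[of l "real_of_int m"] bd[of m]]
    unfolding nn interaction_translate[OF l] emeasure_box[OF l] int
    by (simp only: coupling_def I.emeasure_eq_measure)
  also have "\<dots> = ennreal ((b * l)\<^sup>2 + (if n = m then b * l else 0))"
    using l by (auto simp: ennreal_mult[symmetric] ennreal_plus[symmetric] power2_eq_square ac_simps simp del: ennreal_plus)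
  finally have eq: "(\<integral>\<^sup>+X. ennreal (N n X * N m X) \<partial>P) + ennreal (coupling l (m - n)) = ennreal ((b * l)\<^sup>2 + (if n = m then b * l else 0))" .
  have fin: "(\<integral>\<^sup>+X. ennreal (N n X * N m X) \<partial>P) < \<infinity>"
    using eq by (metis ennreal_add_eq_top ennreal_neq_top infinity_ennreal_def less_top)
  have pos: "0 \<le> N n X * N m X" for X by (simp add: N_def box_count_def)
  show int': "integrable P (\<lambda>X. N n X * N m X)"
    using fin pos by (intro integrableI_nonneg) (auto simp: N_def)
  have "(\<integral>\<^sup>+X. ennreal (N n X * N m X) \<partial>P) = ennreal (LINT X|P. N n X * N m X)"
    using pos by (intro nn_integral_eq_integral int') auto
  with eq have "ennreal ((LINT X|P. N n X * N m X) + coupling l (m - n)) = ennreal ((b * l)\<^sup>2 + (if n = m then b * l else 0))"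
    using pos by (subst ennreal_plus) (auto simp: coupling_def intro: Bochner_Integration.integral_nonneg)
  moreover have "0 \<le> (LINT X|P. N n X * N m X)" using pos by (intro Bochner_Integration.integral_nonneg) auto
  moreover have "0 \<le> coupling l (m - n)" by (simp add: coupling_def)
  ultimately show "(LINT X|P. N n X * N m X) = (b * l)\<^sup>2 - coupling l (m - n) + (if n = m then b * l else 0)"
    using l by (subst (asm) ennreal_inj) auto
qed

text \<open>
  Since the coefficients sum to zero, the product of the means drops out and the second moment is the
  variance.
\<close>

lemma linear_statistic_second_moment:
  assumes l: "l > 0" and W: "finite W" and c: "(\<Sum>n\<in>W. c n) = 0"
  shows "(LINT X|P. (\<Sum>n\<in>W. c n * box_count l (real_of_int n) X)\<^sup>2) =
    b * l * (\<Sum>n\<in>W. (c n)\<^sup>2) - (\<Sum>n\<in>W. \<Sum>m\<in>W. c n * c m * coupling l (m - n))"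
proof -
  let ?N = "\<lambda>n. box_count l (real_of_int n)"
  note int = box_count_product[OF l]
  have "(LINT X|P. (\<Sum>n\<in>W. c n * ?N n X)\<^sup>2) = (LINT X|P. (\<Sum>n\<in>W. \<Sum>m\<in>W. (c n * c m) * (?N n X * ?N m X)))"
    by (simp add: power2_eq_square sum_product ac_simps)
  also have "\<dots> = (\<Sum>n\<in>W. \<Sum>m\<in>W. (c n * c m) * (LINT X|P. ?N n X * ?N m X))"
    using int(1) by (subst Bochner_Integration.integral_sum; (subst Bochner_Integration.integral_sum)?) auto
  also have "\<dots> = (\<Sum>n\<in>W. \<Sum>m\<in>W. (b * l)\<^sup>2 * (c n * c m) - c n * c m * coupling l (m - n) + (if n = m then b * l * (c n)\<^sup>2 else 0))"
    unfolding int(2) by (intro sum.cong refl) (auto simp: algebra_simps power2_eq_square)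
  also have "\<dots> = (b * l)\<^sup>2 * ((\<Sum>n\<in>W. c n) * (\<Sum>n\<in>W. c n)) - (\<Sum>n\<in>W. \<Sum>m\<in>W. c n * c m * coupling l (m - n)) + b * l * (\<Sum>n\<in>W. (c n)\<^sup>2)"
  proof -
    have "(\<Sum>n\<in>W. \<Sum>m\<in>W. (b * l)\<^sup>2 * (c n * c m)) = (b * l)\<^sup>2 * ((\<Sum>n\<in>W. c n) * (\<Sum>n\<in>W. c n))"
      by (subst sum_product) (simp only: sum_distrib_left)
    moreover have "(\<Sum>n\<in>W. \<Sum>m\<in>W. if n = m then b * l * (c n)\<^sup>2 else 0) = b * l * (\<Sum>n\<in>W. (c n)\<^sup>2)"
      using W by (simp add: sum_distrib_left)
    ultimately show ?thesis by (simp only: sum.distrib sum_subtractf)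
  qed
  finally show ?thesis using c by simp
qed

lemma linearly_rigid_process: "linearly_rigid P"
  unfolding linearly_rigid_def
proof (intro allI impI conjI ballI)
  fix l :: real assume l: "l > 0"
  let ?N = "\<lambda>n :: int. box_count l (real_of_int n)"
  have sq: "?N n \<in> square_integrable P" for n
    using box_count_product(1)[OF l, of n n] by (auto simp: square_integrable_def power2_eq_square)
  then show "box_count l n \<in> square_integrable P" if "n \<in> integer_lattice" for n
    using that by (auto simp: integer_lattice_real)
  show "box_count l 0 \<in> L2_closed_span P (box_count l ` (integer_lattice - {0}))"
    unfolding L2_closed_span_def
  proof (intro CollectI conjI allI impI)
    show "box_count l 0 \<in> square_integrable P" using sq[of 0] by simp
    fix e :: real assume e: "e > 0"
    obtain c :: "int \<Rightarrow> real" and L :: nat where c: "c 0 = 1" "(\<Sum>n\<in>{-int L..int L}. c n) = 0"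
      "b * l * (\<Sum>n\<in>{-int L..int L}. (c n)\<^sup>2) - (\<Sum>n\<in>{-int L..int L}. \<Sum>m\<in>{-int L..int L}. c n * c m * coupling l (m - n)) < e\<^sup>2"
      by (rule coefficients_with_small_variance[of "coupling l" "tail_constant l" "b * l" "e\<^sup>2"])
         (use coupling_tail[OF l] coupling_total[OF l] e in \<open>auto simp: coupling_def\<close>)
    let ?W = "{-int L..int L}"
    let ?F = "?N ` (?W - {0})"
    let ?c = "\<lambda>g. - c (the_inv ?N g)"
    have eq: "box_count l 0 X - (\<Sum>g\<in>?F. ?c g * g X) = (\<Sum>n\<in>?W. c n * ?N n X)" for X
    proof -
      have "(\<Sum>g\<in>?F. ?c g * g X) = (\<Sum>n\<in>?W - {0}. - c n * ?N n X)"
      proof -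
        have inv: "the_inv ?N (?N n) = n" for n by (rule the_inv_f_f[OF box_count_inj[OF l]])
        have inj: "inj_on ?N (?W - {0})" by (rule inj_on_subset[OF box_count_inj[OF l]]) simp
        show ?thesis unfolding sum.reindex[OF inj] o_def inv ..
      qed
      moreover have "(\<Sum>n\<in>?W. c n * ?N n X) = ?N 0 X + (\<Sum>n\<in>?W - {0}. c n * ?N n X)"
        using c(1) by (subst sum.remove[of _ 0]) auto
      ultimately show ?thesis by (simp add: sum_negf)
    qed
    show "\<exists>F c. finite F \<and> F \<subseteq> box_count l ` (integer_lattice - {0}) \<and>
        sqrt (LINT X|P. (box_count l 0 X - (\<Sum>g\<in>F. c g * g X))\<^sup>2) < e"
    proof (intro exI conjI)
      show "finite ?F" by simp
      show "?F \<subseteq> box_count l ` (integer_lattice - {0})" by (auto simp: integer_lattice_real)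
      have "(LINT X|P. (box_count l 0 X - (\<Sum>g\<in>?F. ?c g * g X))\<^sup>2) < e\<^sup>2"
        unfolding eq using linear_statistic_second_moment[OF l _ c(2)] c(3) by simp
      then show "sqrt (LINT X|P. (box_count l 0 X - (\<Sum>g\<in>?F. ?c g * g X))\<^sup>2) < e"
        using e by (intro real_less_lsqrt) auto
    qed
  qed
qed

end

theorem theorem4p3:
  fixes B :: "real set" and P :: "real set measure"
  assumes "B \<in> sets borel" and "bounded B"
    and "(SUP R\<in>{0<..}. ennreal R *
           (\<integral>\<^sup>+ \<xi> \<in> {\<xi>. \<bar>\<xi>\<bar> \<ge> R}. ennreal ((cmod (fourier_transform (indicator B) \<xi>))\<^sup>2) \<partial>lborel)) < \<infinity>"
    and "determinantal_process (\<lambda>x y. fourier_transform (indicator B) (x - y)) P"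
  shows "linearly_rigid P"
proof -
  let ?T = "\<lambda>R. \<integral>\<^sup>+t. indicator {t. \<bar>t\<bar> \<ge> R} t * ennreal (spectral_kernel B t) \<partial>lborel"
  define S where "S = (SUP R\<in>{0<..}. ennreal R * ?T R)"
  have S: "S < \<infinity>" using assms(3) by (simp add: S_def mult.commute)
  have "?T R \<le> ennreal (enn2real S / R)" if "R > 0" for R
  proof -
    have "ennreal R * ?T R \<le> ennreal (enn2real S)"
      using S that unfolding S_def by (subst ennreal_enn2real) (auto intro: SUP_upper)
    then have "ennreal (1 / R) * (ennreal R * ?T R) \<le> ennreal (1 / R) * ennreal (enn2real S)"
      by (rule mult_left_mono) simp
    moreover have "ennreal (1 / R) * ennreal R = 1" using that by (subst ennreal_mult[symmetric]) auto
    ultimately show ?thesis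
      using that by (simp add: mult.assoc[symmetric] ennreal_mult'[symmetric])
  qed
  then interpret decaying_determinantal B P "enn2real S"
    by unfold_locales (use assms in auto)
  show ?thesis by (rule linearly_rigid_process)
qed

end
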